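(* Let $V=\mathrm{pt}$ be a single point, so that $\Lambda=\mathbb Q[v,v^{-1}]$, and let $*=*_{\mathrm{pt}}$ be the quantum product on $MU^*_\Lambda(\mathrm{pt})$ (defined in the context). Then the coupling constant $q:=1*1$ of the associated topological field theory is $$q=\sum_{k\ge0}\,[\overline{\mathcal M}{}_0^{k+3}]\,v_{(k)}\in MU^0_\Lambda(\mathrm{pt}),$$ and the quantum product on $MU^*_\Lambda(\mathrm{pt})$ is given by $x*y=q\,x\,y$ for all $x,y\in MU^*_\Lambda(\mathrm{pt})$, where the product on the right is the usual one.
   Context: Here $v$ has cohomological degree $2$, $v_{(k)}=v^k/k!$, and $MU^*_\Lambda(\mathrm{pt})=MU^*(\mathrm{pt})\hat\otimes\mathbb Q[v,v^{-1}]$ is the completed tensor product, i.e. the graded ring of formal Laurent series in $v$ with coefficients in $MU^*(\mathrm{pt})\otimes\mathbb Q$; $\mathbf{MU}_\Lambda$ is the corresponding spectrum. $\overline{\mathcal M}{}_0^{n}$ ($n\ge3$) is the Deligne–Mumford–Knudsen moduli space of stable genus-zero curves with $n$ ordered smooth marked points, a compact complex manifold of complex dimension $n-3$, and $[\overline{\mathcal M}{}_0^{k+3}]\in MU^{-2k}(\mathrm{pt})$ is its complex cobordism class, i.e. the class of the map $\overline{\mathcal M}{}_0^{k+3}\to\overline{\mathcal M}{}_0^3=\mathrm{pt}$ that forgets the last $k$ marked points. Quantum product. For a variety $V$ of complex dimension $d$, let $\overline{\mathcal M}{}_0^{n}(V,\alpha)$ be the stack of stable maps of degree $\alpha\in H_2(V,\mathbb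 Z)$ from genus-zero curves with $n$ ordered smooth marked points to $V$, and let $\tau^3_{V,0}=v^{-2d}\sum_{k\ge0}\sum_{\alpha}[\overline{\mathcal M}{}_0^{3+k}(V,\alpha)\to V^3]\,\alpha\otimes v_{(k)}$, where the maps evaluate at the first three marked points. The trace $\mathrm{Tr}_V:\mathbf{MU}_\Lambda(V)\to\mathbf{MU}_\Lambda$ is the cobordism transfer of $V\to\mathrm{pt}$ followed by multiplication by $v^d$, where $\mathbf{MU}_\Lambda(V)=F(V^+,\mathbf{MU}_\Lambda)$, and $b_V$ is the usual multiplication of $\mathbf{MU}_\Lambda(V)$ followed by $\mathrm{Tr}_V$. The quantum product $*_V$ is the composite $$\mathbf{MU}_\Lambda(V)\wedge S^0\wedge\mathbf{MU}_\Lambda(V)\xrightarrow{\mathrm{id}\wedge\tau^3_{V,0}\wedge\mathrm{id}}\mathbf{MU}_\Lambda(V^5)\xrightarrow{b_V^{\otimes2}\wedge\mathrm{id}}\mathbf{MU}_\Lambda(V),$$ in which the two copies of $b_V$ pair the two outer factors of $V^5$ with two of the three middle factors. The coupling constant is $q_V=1*_V1$. For $V=\mathrm{pt}$ one has $d=0$, the only degree is $\alpha=0$, and $\overline{\mathcal M}{}_0^{n}(\mathrm{pt},0)=\overline{\mathcal M}{}_0^{n}$. *)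

theory Defs
  imports
    "HOL-Analysis.Analysis"
    "HOL-Library.Poly_Mapping"
    "HOL-Computational_Algebra.Formal_Laurent_Series"
begin

section \<open>A universal ambient space\<close>

text \<open>All closed manifolds are realised inside finite coordinate subspaces of one fixed normed space,
  the bounded real sequences. Only the subspaces \<open>Rn N\<close> matter; they play the role of \<open>R^N\<close>.\<close>

type_synonym rseq = "nat \<Rightarrow>\<^sub>C real"

setup_lifting type_definition_bcontfun

lemma nat_bcontfunI:
  fixes f :: "nat \<Rightarrow> real"
  assumes "\<And>i. \<bar>f i\<bar> \<le> B"
  shows "f \<in> bcontfun"
proof -
  have "continuous_on UNIV f" by simp
  moreover have "bounded (range f)"
    using assms by (auto simp: bounded_iff)
  ultimately show ?thesis by (simp add: bcontfun_def)
qed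

lemma rseq_bound: "\<bar>apply_bcontfun (x :: rseq) i\<bar> \<le> norm x"
  using norm_bounded[of x i] by simp

definition Rn :: "nat \<Rightarrow> rseq set" where
  "Rn N = {x. \<forall>i\<ge>N. apply_bcontfun x i = 0}"

lift_definition seq_cons :: "real \<Rightarrow> rseq \<Rightarrow> rseq" is
  "\<lambda>s x i. case i of 0 \<Rightarrow> s | Suc j \<Rightarrow> x j"
proof -
  fix s :: real and x :: "nat \<Rightarrow> real" assume "x \<in> bcontfun"
  then obtain B where B: "\<And>i. \<bar>x i\<bar> \<le> B" by (auto simp: bcontfun_def bounded_iff)
  show "(\<lambda>i. case i of 0 \<Rightarrow> s | Suc j \<Rightarrow> x j) \<in> bcontfun"
    by (rule nat_bcontfunI[where B = "max \<bar>s\<bar> B"]) (auto simp: le_max_iff_disj B split: nat.split)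
qed

lift_definition seq_take :: "nat \<Rightarrow> rseq \<Rightarrow> rseq" is "\<lambda>k x i. if i < k then x i else 0"
proof -
  fix k :: nat and x :: "nat \<Rightarrow> real" assume "x \<in> bcontfun"
  then obtain B where B: "\<And>i. \<bar>x i\<bar> \<le> B" by (auto simp: bcontfun_def bounded_iff)
  have "0 \<le> B" using B[of 0] by linarith
  then show "(\<lambda>i. if i < k then x i else 0) \<in> bcontfun"
    by (intro nat_bcontfunI[where B = B]) (auto simp: B)
qed

lift_definition seq_drop :: "nat \<Rightarrow> rseq \<Rightarrow> rseq" is "\<lambda>k x i. x (i + k)"
proof -
  fix k :: nat and x :: "nat \<Rightarrow> real" assume "x \<in> bcontfun"
  then obtain B where B: "\<And>i. \<bar>x i\<bar> \<le> B" by (auto simp: bcontfun_def bounded_iff)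
  then show "(\<lambda>i. x (i + k)) \<in> bcontfun" by (intro nat_bcontfunI[where B = B])
qed

lift_definition seq_append :: "nat \<Rightarrow> rseq \<Rightarrow> rseq \<Rightarrow> rseq" is
  "\<lambda>k x y i. if i < k then x i else y (i - k)"
proof -
  fix k :: nat and x y :: "nat \<Rightarrow> real" assume "x \<in> bcontfun" "y \<in> bcontfun"
  then obtain B C where B: "\<And>i. \<bar>x i\<bar> \<le> B" and C: "\<And>i. \<bar>y i\<bar> \<le> C"
    by (auto simp: bcontfun_def bounded_iff)
  show "(\<lambda>i. if i < k then x i else y (i - k)) \<in> bcontfun"
    by (rule nat_bcontfunI[where B = "max B C"]) (auto simp: le_max_iff_disj B C)
qed

text \<open>The linear isomorphism of \<open>rseq \<times> rseq\<close> with \<open>rseq\<close> used to realise products.\<close>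

lift_definition interleave :: "rseq \<Rightarrow> rseq \<Rightarrow> rseq" is
  "\<lambda>x y i. if even i then x (i div 2) else y (i div 2)"
proof -
  fix x y :: "nat \<Rightarrow> real" assume "x \<in> bcontfun" "y \<in> bcontfun"
  then obtain B C where B: "\<And>i. \<bar>x i\<bar> \<le> B" and C: "\<And>i. \<bar>y i\<bar> \<le> C"
    by (auto simp: bcontfun_def bounded_iff)
  show "(\<lambda>i. if even i then x (i div 2) else y (i div 2)) \<in> bcontfun"
    by (rule nat_bcontfunI[where B = "max B C"]) (auto simp: le_max_iff_disj B C)
qed

lift_definition seq_evens :: "rseq \<Rightarrow> rseq" is "\<lambda>x i. x (2 * i)"
proof -
  fix x :: "nat \<Rightarrow> real" assume "x \<in> bcontfun"
  then obtain B where B: "\<And>i. \<bar>x i\<bar> \<le> B" by (auto simp: bcontfun_def bounded_iff)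
  then show "(\<lambda>i. x (2 * i)) \<in> bcontfun" by (intro nat_bcontfunI[where B = B])
qed

lift_definition seq_odds :: "rseq \<Rightarrow> rseq" is "\<lambda>x i. x (2 * i + 1)"
proof -
  fix x :: "nat \<Rightarrow> real" assume "x \<in> bcontfun"
  then obtain B where B: "\<And>i. \<bar>x i\<bar> \<le> B" by (auto simp: bcontfun_def bounded_iff)
  then show "(\<lambda>i. x (2 * i + 1)) \<in> bcontfun" by (intro nat_bcontfunI[where B = B])
qed

section \<open>Smooth manifolds\<close>

text \<open>Smoothness of maps between arbitrary subsets, and submanifolds, as in Milnor's
  \<open>Topology from the Differentiable Viewpoint\<close>: a map on \<open>A\<close> is smooth if it extends locally to a
  smooth map on an open set of the ambient space.\<close>

fun Ck_on :: "nat \<Rightarrow> 'a::real_normed_vector set \<Rightarrow> ('a \<Rightarrow> 'b::real_normed_vector) \<Rightarrow> bool" where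
  "Ck_on 0 U f \<longleftrightarrow> continuous_on U f"
| "Ck_on (Suc k) U f \<longleftrightarrow> (\<forall>x\<in>U. f differentiable (at x)) \<and>
     (\<forall>v. Ck_on k U (\<lambda>x. frechet_derivative f (at x) v))"

definition smooth_map :: "'a::real_normed_vector set \<Rightarrow> ('a \<Rightarrow> 'b::real_normed_vector) \<Rightarrow> bool" where
  "smooth_map A f \<longleftrightarrow>
     (\<forall>x\<in>A. \<exists>U g. open U \<and> x \<in> U \<and> (\<forall>k. Ck_on k U g) \<and> (\<forall>y\<in>A \<inter> U. f y = g y))"

definition diffeo ::
  "'a::real_normed_vector set \<Rightarrow> 'b::real_normed_vector set \<Rightarrow> ('a \<Rightarrow> 'b) \<Rightarrow> bool" where
  "diffeo A B f \<longleftrightarrow> bij_betw f A B \<and> smooth_map A f \<and> smooth_map B (the_inv_into A f)"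

text \<open>Submanifolds of dimension \<open>d\<close> (without boundary).\<close>

definition manifold :: "nat \<Rightarrow> 'a::real_normed_vector set \<Rightarrow> bool" where
  "manifold d M \<longleftrightarrow>
     (\<forall>x\<in>M. \<exists>U V \<phi>. openin (top_of_set M) U \<and> x \<in> U \<and> openin (top_of_set (Rn d)) V \<and> diffeo V U \<phi>)"

text \<open>The tangent space: spanned by the one-sided velocities at \<open>x\<close> of curves in \<open>M\<close>.\<close>

definition tangent :: "'a::real_normed_vector set \<Rightarrow> 'a \<Rightarrow> 'a set" where
  "tangent M x = span {w. \<exists>\<gamma>. \<gamma> 0 = x \<and> (\<forall>t\<ge>0. \<gamma> t \<in> M) \<and>
     (\<gamma> has_vector_derivative w) (at 0 within {0::real..})}"

section \<open>Stably complex manifolds and bordism\<close>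

text \<open>A complex structure on the vector bundle \<open>TM \<oplus> R^k\<close>. Only the restriction of \<open>J x\<close> to
  the fibre is relevant.\<close>

definition stable_fibre :: "'a::real_normed_vector set \<Rightarrow> nat \<Rightarrow> 'a \<Rightarrow> ('a \<times> rseq) set" where
  "stable_fibre M k x = tangent M x \<times> Rn k"

definition stable_cx ::
  "'a::real_normed_vector set \<Rightarrow> nat \<Rightarrow> ('a \<Rightarrow> 'a \<times> rseq \<Rightarrow> 'a \<times> rseq) \<Rightarrow> bool" where
  "stable_cx M k J \<longleftrightarrow>
     (\<forall>x\<in>M. linear (J x) \<and> J x ` stable_fibre M k x \<subseteq> stable_fibre M k x \<and>
        (\<forall>z\<in>stable_fibre M k x. J x (J x z) = - z)) \<and>
     smooth_map (Sigma M (stable_fibre M k)) (\<lambda>(x, z). J x z)"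

type_synonym sc_struct = "rseq \<Rightarrow> rseq \<times> rseq \<Rightarrow> rseq \<times> rseq"

definition closed_scm :: "nat \<times> rseq set \<times> nat \<times> sc_struct \<Rightarrow> bool" where
  "closed_scm = (\<lambda>(d, M, k, J). compact M \<and> (\<exists>N. M \<subseteq> Rn N) \<and> manifold d M \<and> stable_cx M k J)"

text \<open>Closed stably complex manifolds \<open>(d, M, k, J)\<close>: the dimension, the underlying manifold,
  the rank of the stabilisation and the complex structure.\<close>

typedef scm = "{X. closed_scm X}"
proof -
  have "closed_scm (0, {}, 0, \<lambda>_ z. z)"
    by (simp add: closed_scm_def manifold_def stable_cx_def smooth_map_def)
  then show ?thesis by blast
qed

definition scm_dim :: "scm \<Rightarrow> nat" where
  "scm_dim X = fst (Rep_scm X)"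

text \<open>The product, with \<open>T(M \<times> N) \<oplus> R^(k+l)\<close> identified with
  \<open>(TM \<oplus> R^k) \<oplus> (TN \<oplus> R^l)\<close> by reordering the summands.\<close>

definition prod_struct :: "nat \<Rightarrow> sc_struct \<Rightarrow> sc_struct \<Rightarrow> sc_struct" where
  "prod_struct k J J' = (\<lambda>p (u, a).
     let (w, b) = J (seq_evens p) (seq_evens u, seq_take k a);
         (w', b') = J' (seq_odds p) (seq_odds u, seq_drop k a)
     in (interleave w w', seq_append k b b'))"

definition scm_prod :: "scm \<Rightarrow> scm \<Rightarrow> scm" where
  "scm_prod X Y = (case (Rep_scm X, Rep_scm Y) of ((d, M, k, J), (e, N, l, J')) \<Rightarrow>
     Abs_scm (d + e, (\<lambda>(x, y). interleave x y) ` (M \<times> N), k + l, prod_struct k J J'))"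

definition scm_point :: scm where
  "scm_point = Abs_scm (0, {0}, 0, \<lambda>_ z. z)"

text \<open>Adding a trivial complex line: \<open>J \<oplus> i\<close> on \<open>(TM \<oplus> R^k) \<oplus> R^2\<close>.\<close>

definition stab_struct :: "nat \<Rightarrow> sc_struct \<Rightarrow> sc_struct" where
  "stab_struct k J = (\<lambda>x (w, a). let (w', b) = J x (w, seq_take k a) in
     (w', seq_append k b (seq_cons (- apply_bcontfun a (k + 1)) (seq_cons (apply_bcontfun a k) 0))))"

text \<open>A bordism is, as in Quillen's geometric description, a manifold \<open>W\<close> without boundary with a map
  \<open>p\<close> to \<open>R\<close> that is proper over \<open>[0,1]\<close>; it is moreover assumed to be a product
  near \<open>p = 0\<close> and \<open>p = 1\<close>. \<open>collar\<close> says that \<open>c\<close> is a diffeomorphism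
  from \<open>M \<times> ]-e,e[\<close> onto a neighbourhood of the fibre over \<open>a\<close>, and that
  the structure on \<open>TW \<oplus> R^k\<close> restricts on this fibre to the structure on
  \<open>TM \<oplus> R^(k+1)\<close>, the coordinate vector field of \<open>R\<close> being identified with the
  first basis vector of \<open>R^(k+1)\<close>.\<close>

definition collar :: "rseq set \<Rightarrow> nat \<Rightarrow> sc_struct \<Rightarrow> (rseq \<times> real) set \<Rightarrow> (rseq \<times> real \<Rightarrow> real) \<Rightarrow>
    (rseq \<times> real \<Rightarrow> (rseq \<times> real) \<times> rseq \<Rightarrow> (rseq \<times> real) \<times> rseq) \<Rightarrow> real \<Rightarrow> bool" where
  "collar M k J W p JW a \<longleftrightarrow> (\<exists>e>0. \<exists>c.
     diffeo (M \<times> {-e<..<e}) {z\<in>W. a - e < p z \<and> p z < a + e} c \<and>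
     (\<forall>x\<in>M. \<forall>t\<in>{-e<..<e}. p (c (x, t)) = a + t) \<and>
     (\<forall>x\<in>M. \<exists>D. (c has_derivative D) (at (x, 0) within M \<times> {-e<..<e}) \<and>
        (\<forall>w\<in>tangent M x. \<forall>s. \<forall>b\<in>Rn k. JW (c (x, 0)) (D (w, s), b) =
           (let (w', b') = J x (w, seq_cons s b) in (D (w', apply_bcontfun b' 0), seq_drop 1 b')))))"

definition cobordant :: "scm \<Rightarrow> scm \<Rightarrow> bool" where
  "cobordant X Y \<longleftrightarrow> (\<exists>d k M\<^sub>0 J\<^sub>0 M\<^sub>1 J\<^sub>1 N W p JW.
     Rep_scm X = (d, M\<^sub>0, Suc k, J\<^sub>0) \<and> Rep_scm Y = (d, M\<^sub>1, Suc k, J\<^sub>1) \<and>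
     W \<subseteq> Rn N \<times> UNIV \<and> manifold (Suc d) W \<and> stable_cx W k JW \<and>
     smooth_map W p \<and> compact {z\<in>W. 0 \<le> p z \<and> p z \<le> 1} \<and>
     collar M\<^sub>0 k J\<^sub>0 W p JW 0 \<and> collar M\<^sub>1 k J\<^sub>1 W p JW 1)"

definition stabilisation :: "scm \<Rightarrow> scm \<Rightarrow> bool" where
  "stabilisation X Y \<longleftrightarrow> (\<exists>d M k J. Rep_scm X = (d, M, k, J) \<and>
     Rep_scm Y = (d, M, k + 2, stab_struct k J))"

definition disjoint_union :: "scm \<Rightarrow> scm \<Rightarrow> scm \<Rightarrow> bool" where
  "disjoint_union P X Y \<longleftrightarrow> (\<exists>d M N k J. Rep_scm X = (d, M, k, J) \<and> Rep_scm Y = (d, N, k, J) \<and>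
     M \<inter> N = {} \<and> Rep_scm P = (d, M \<union> N, k, J))"

section \<open>The ring \<open>MU\<^sup>*(pt) \<otimes> Q\<close>\<close>

text \<open>The complex bordism ring tensored with \<open>Q\<close>: the \<open>Q\<close>-algebra spanned by the closed stably complex manifolds,
  with cartesian product as multiplication, modulo the two-sided ideal generated by
  bordism, stabilisation, and ``disjoint union is sum''.\<close>

definition free_mult :: "(scm \<Rightarrow>\<^sub>0 rat) \<Rightarrow> (scm \<Rightarrow>\<^sub>0 rat) \<Rightarrow> (scm \<Rightarrow>\<^sub>0 rat)" where
  "free_mult f g = (\<Sum>X\<in>Poly_Mapping.keys f. \<Sum>Y\<in>Poly_Mapping.keys g. Poly_Mapping.single (scm_prod X Y)
     (Poly_Mapping.lookup f X * Poly_Mapping.lookup g Y))"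

definition free_scale :: "rat \<Rightarrow> (scm \<Rightarrow>\<^sub>0 rat) \<Rightarrow> (scm \<Rightarrow>\<^sub>0 rat)" where
  "free_scale c f = (\<Sum>X\<in>Poly_Mapping.keys f. Poly_Mapping.single X (c * Poly_Mapping.lookup f X))"

inductive_set bordism_ideal :: "(scm \<Rightarrow>\<^sub>0 rat) set" where
  cobordant: "cobordant X Y \<Longrightarrow> Poly_Mapping.single X c - Poly_Mapping.single Y c \<in> bordism_ideal"
| stabilisation: "stabilisation X Y \<Longrightarrow> Poly_Mapping.single X c - Poly_Mapping.single Y c \<in> bordism_ideal"
| disjoint_union: "disjoint_union P X Y \<Longrightarrow>
    Poly_Mapping.single P c - Poly_Mapping.single X c - Poly_Mapping.single Y c \<in> bordism_ideal"
| zero: "0 \<in> bordism_ideal"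
| add: "f \<in> bordism_ideal \<Longrightarrow> g \<in> bordism_ideal \<Longrightarrow> f + g \<in> bordism_ideal"
| scale: "f \<in> bordism_ideal \<Longrightarrow> free_scale c f \<in> bordism_ideal"
| mult_left: "f \<in> bordism_ideal \<Longrightarrow> free_mult g f \<in> bordism_ideal"
| mult_right: "f \<in> bordism_ideal \<Longrightarrow> free_mult f g \<in> bordism_ideal"

lemma free_mult_superset:
  assumes "finite S" "finite T" "Poly_Mapping.keys f \<subseteq> S" "Poly_Mapping.keys g \<subseteq> T"
  shows "free_mult f g = (\<Sum>X\<in>S. \<Sum>Y\<in>T. Poly_Mapping.single (scm_prod X Y)
     (Poly_Mapping.lookup f X * Poly_Mapping.lookup g Y))"
proof -
  have inner: "(\<Sum>Y\<in>Poly_Mapping.keys g. Poly_Mapping.single (scm_prod X Y) (Poly_Mapping.lookup f X * Poly_Mapping.lookup g Y))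
      = (\<Sum>Y\<in>T. Poly_Mapping.single (scm_prod X Y) (Poly_Mapping.lookup f X * Poly_Mapping.lookup g Y))" for X
    using assms by (intro sum.mono_neutral_left) (auto simp: in_keys_iff)
  show ?thesis
    unfolding free_mult_def inner
    using assms by (intro sum.mono_neutral_left) (auto simp: in_keys_iff)
qed

lemma free_mult_minus_left: "free_mult (f - g) h = free_mult f h - free_mult g h"
proof -
  let ?S = "Poly_Mapping.keys f \<union> Poly_Mapping.keys g \<union> Poly_Mapping.keys (f - g)"
  have fin: "finite ?S" "finite (Poly_Mapping.keys h)" by auto
  note sup = free_mult_superset[OF fin]
  show ?thesis
    by (subst (1 2 3) sup) (auto simp: lookup_minus left_diff_distrib single_diff sum_subtractf)
qed

lemma free_mult_minus_right: "free_mult h (f - g) = free_mult h f - free_mult h g"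
proof -
  let ?S = "Poly_Mapping.keys f \<union> Poly_Mapping.keys g \<union> Poly_Mapping.keys (f - g)"
  have fin: "finite (Poly_Mapping.keys h)" "finite ?S" by auto
  note sup = free_mult_superset[OF fin]
  show ?thesis
    by (subst (1 2 3) sup) (auto simp: lookup_minus right_diff_distrib single_diff sum_subtractf)
qed

lemma lookup_free_scale: "Poly_Mapping.lookup (free_scale c f) X = c * Poly_Mapping.lookup f X"
  by (cases "X \<in> Poly_Mapping.keys f")
    (auto simp: free_scale_def lookup_sum lookup_single when_def in_keys_iff)

lemma free_scale_minus: "free_scale c (f - g) = free_scale c f - free_scale c g"
  by (rule poly_mapping_eqI) (simp add: lookup_free_scale lookup_minus algebra_simps)

lemma bordism_ideal_uminus: "f \<in> bordism_ideal \<Longrightarrow> - f \<in> bordism_ideal"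
proof -
  assume f: "f \<in> bordism_ideal"
  have "- f = free_scale (-1) f"
    by (rule poly_mapping_eqI) (simp add: lookup_free_scale)
  with bordism_ideal.scale[OF f] show ?thesis by metis
qed

lemma bordism_ideal_minus:
  "f \<in> bordism_ideal \<Longrightarrow> g \<in> bordism_ideal \<Longrightarrow> f - g \<in> bordism_ideal"
  using bordism_ideal.add[OF _ bordism_ideal_uminus] by fastforce

quotient_type mu = "scm \<Rightarrow>\<^sub>0 rat" / "\<lambda>f g. f - g \<in> bordism_ideal"
proof (intro equivpI reflpI sympI transpI)
  fix f g h :: "scm \<Rightarrow>\<^sub>0 rat"
  show "f - f \<in> bordism_ideal" by (simp add: bordism_ideal.zero)
  show "g - f \<in> bordism_ideal" if "f - g \<in> bordism_ideal"
    using bordism_ideal_uminus[OF that] by simp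
  show "f - h \<in> bordism_ideal" if "f - g \<in> bordism_ideal" "g - h \<in> bordism_ideal"
    using bordism_ideal.add[OF that] by simp
qed

instantiation mu :: "{ab_group_add, one, times}"
begin

lift_definition zero_mu :: mu is 0 .

lift_definition one_mu :: mu is "Poly_Mapping.single scm_point 1" .

lift_definition plus_mu :: "mu \<Rightarrow> mu \<Rightarrow> mu" is "(+)"
proof -
  fix f f' g g' :: "scm \<Rightarrow>\<^sub>0 rat"
  assume "f - f' \<in> bordism_ideal" "g - g' \<in> bordism_ideal"
  from bordism_ideal.add[OF this] show "f + g - (f' + g') \<in> bordism_ideal"
    by (simp add: algebra_simps)
qed

lift_definition minus_mu :: "mu \<Rightarrow> mu \<Rightarrow> mu" is "(-)"
proof -
  fix f f' g g' :: "scm \<Rightarrow>\<^sub>0 rat"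
  assume "f - f' \<in> bordism_ideal" "g - g' \<in> bordism_ideal"
  from bordism_ideal_minus[OF this] show "f - g - (f' - g') \<in> bordism_ideal"
    by (simp add: algebra_simps)
qed

lift_definition uminus_mu :: "mu \<Rightarrow> mu" is uminus
proof -
  fix f f' :: "scm \<Rightarrow>\<^sub>0 rat"
  assume "f - f' \<in> bordism_ideal"
  from bordism_ideal_uminus[OF this] show "- f - - f' \<in> bordism_ideal"
    by (simp add: algebra_simps)
qed

lift_definition times_mu :: "mu \<Rightarrow> mu \<Rightarrow> mu" is free_mult
proof -
  fix f f' g g' :: "scm \<Rightarrow>\<^sub>0 rat"
  assume *: "f - f' \<in> bordism_ideal" "g - g' \<in> bordism_ideal"
  have "free_mult f g - free_mult f' g' = free_mult (f - f') g + free_mult f' (g - g')"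
    by (simp add: free_mult_minus_left free_mult_minus_right)
  then show "free_mult f g - free_mult f' g' \<in> bordism_ideal"
    using * by (simp add: bordism_ideal.intros)
qed

instance
  by standard (transfer, simp add: algebra_simps bordism_ideal.zero)+

end

lift_definition scaleQ :: "rat \<Rightarrow> mu \<Rightarrow> mu" is free_scale
  by (simp add: free_scale_minus[symmetric] bordism_ideal.scale)

lift_definition bordism_class :: "scm \<Rightarrow> mu" is "\<lambda>X. Poly_Mapping.single X 1" .

text \<open>\<open>MU^m(pt) \<otimes> Q\<close> (cohomological grading): a \<open>d\<close>-manifold has degree \<open>-d\<close>.\<close>

definition MU_degree :: "int \<Rightarrow> mu set" where
  "MU_degree m = abs_mu ` {f. \<forall>X\<in>Poly_Mapping.keys f. int (scm_dim X) = - m}"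

section \<open>The ring \<open>MU\<^sup>*\<^sub>\<Lambda>(pt)\<close>\<close>

text \<open>Formal Laurent series in \<open>v = fls_X\<close>, which has degree 2. A homogeneous element of degree
  \<open>n\<close> is a series \<open>\<Sum> a_j v^j\<close> with \<open>a_j\<close> of degree \<open>n - 2j\<close> (this vanishes
  for \<open>j\<close> small, since \<open>MU^m(pt) = 0\<close> for \<open>m > 0\<close>); the graded
  ring is the direct sum of its homogeneous parts.\<close>

definition MUL_degree :: "int \<Rightarrow> mu fls set" where
  "MUL_degree n = {x. \<forall>j. fls_nth x j \<in> MU_degree (n - 2 * j)}"

definition MUL :: "mu fls set" where
  "MUL = {\<Sum>n\<in>S. x n |S x. finite S \<and> (\<forall>n\<in>S. x n \<in> MUL_degree n)}"

text \<open>\<open>\<Sum> a_k v_(k)\<close>, where \<open>v_(k) = v^k / k!\<close>.\<close>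

definition divided_power_series :: "(nat \<Rightarrow> mu) \<Rightarrow> mu fls" where
  "divided_power_series a = fps_to_fls (Abs_fps (\<lambda>k. scaleQ (1 / fact k) (a k)))"

section \<open>Stable curves of genus zero\<close>

text \<open>The projective line: \<open>None\<close> is the point at infinity.\<close>

type_synonym P1 = "complex option"

fun moebius_map :: "complex \<Rightarrow> complex \<Rightarrow> complex \<Rightarrow> complex \<Rightarrow> P1 \<Rightarrow> P1" where
  "moebius_map a b c d None = (if c = 0 then None else Some (a / c))"
| "moebius_map a b c d (Some z) =
     (if c * z + d = 0 then None else Some ((a * z + b) / (c * z + d)))"

definition PGL2 :: "(P1 \<Rightarrow> P1) set" where
  "PGL2 = {moebius_map a b c d |a b c d. a * d - b * c \<noteq> 0}"

fun hom_coords :: "P1 \<Rightarrow> complex \<times> complex" where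
  "hom_coords None = (1, 0)"
| "hom_coords (Some z) = (z, 1)"

definition P1_det :: "P1 \<Rightarrow> P1 \<Rightarrow> complex" where
  "P1_det p q = fst (hom_coords p) * snd (hom_coords q) - fst (hom_coords q) * snd (hom_coords p)"

text \<open>The cross ratio \<open>[(p-r)(q-s) : (p-s)(q-r)]\<close>, meaningful as soon as three of the four points are distinct.\<close>

definition cross_ratio :: "P1 \<Rightarrow> P1 \<Rightarrow> P1 \<Rightarrow> P1 \<Rightarrow> P1" where
  "cross_ratio p q r s = (if P1_det p s * P1_det q r = 0 then None
     else Some ((P1_det p r * P1_det q s) / (P1_det p s * P1_det q r)))"

text \<open>A nodal curve all of whose components are projective lines, presented by its dual graph:
  \<open>node C \<alpha> \<beta>\<close> is the point of the component \<open>\<alpha>\<close> at which it meets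
  the adjacent component \<open>\<beta>\<close>, and \<open>mark C i\<close> is the \<open>i\<close>th marked point (a component and a point on it).\<close>

record marked_curve =
  comps :: "nat set"
  adj :: "(nat \<times> nat) set"
  node :: "nat \<Rightarrow> nat \<Rightarrow> P1"
  mark :: "nat \<Rightarrow> nat \<times> P1"

definition special :: "nat \<Rightarrow> marked_curve \<Rightarrow> nat \<Rightarrow> (nat + nat) set" where
  "special n C \<alpha> = Inl ` {\<beta>. (\<alpha>, \<beta>) \<in> adj C} \<union> Inr ` {i. i < n \<and> fst (mark C i) = \<alpha>}"

definition special_pos :: "marked_curve \<Rightarrow> nat \<Rightarrow> nat + nat \<Rightarrow> P1" where
  "special_pos C \<alpha> s = (case s of Inl \<beta> \<Rightarrow> node C \<alpha> \<beta> | Inr i \<Rightarrow> snd (mark C i))"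

text \<open>Genus zero means that the dual graph is a tree: connected with one edge less than vertices
  (\<open>adj\<close> contains each edge in both directions). Stability means at least three special points on
  each component.\<close>

definition stable_curve :: "nat \<Rightarrow> marked_curve \<Rightarrow> bool" where
  "stable_curve n C \<longleftrightarrow>
     finite (comps C) \<and> comps C \<noteq> {} \<and> adj C \<subseteq> comps C \<times> comps C \<and> sym (adj C) \<and> irrefl (adj C) \<and>
     comps C \<times> comps C \<subseteq> (adj C)\<^sup>* \<and> card (adj C) = 2 * (card (comps C) - 1) \<and>
     (\<forall>i<n. fst (mark C i) \<in> comps C) \<and>
     (\<forall>\<alpha>\<in>comps C. inj_on (special_pos C \<alpha>) (special n C \<alpha>) \<and> 3 \<le> card (special n C \<alpha>))"

definition curve_iso :: "nat \<Rightarrow> marked_curve \<Rightarrow> marked_curve \<Rightarrow> bool" where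
  "curve_iso n C D \<longleftrightarrow> (\<exists>f \<mu>. bij_betw f (comps C) (comps D) \<and>
     (\<forall>\<alpha>\<in>comps C. \<forall>\<beta>\<in>comps C. (\<alpha>, \<beta>) \<in> adj C \<longleftrightarrow> (f \<alpha>, f \<beta>) \<in> adj D) \<and>
     (\<forall>\<alpha>\<in>comps C. \<mu> \<alpha> \<in> PGL2) \<and>
     (\<forall>(\<alpha>, \<beta>)\<in>adj C. node D (f \<alpha>) (f \<beta>) = \<mu> \<alpha> (node C \<alpha> \<beta>)) \<and>
     (\<forall>i<n. mark D i = (case mark C i of (\<alpha>, z) \<Rightarrow> (f \<alpha>, \<mu> \<alpha> z))))"

text \<open>The image of the \<open>i\<close>th marked point on the component \<open>\<alpha>\<close> after collapsing the other components:
  either itself, or the node of \<open>\<alpha>\<close> through which it is reached.\<close>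

definition mark_on :: "marked_curve \<Rightarrow> nat \<Rightarrow> nat \<Rightarrow> P1" where
  "mark_on C \<alpha> i = (if fst (mark C i) = \<alpha> then snd (mark C i)
     else node C \<alpha> (THE \<beta>. (\<alpha>, \<beta>) \<in> adj C \<and>
       (\<beta>, fst (mark C i)) \<in> (adj C \<inter> (- {\<alpha>}) \<times> (- {\<alpha>}))\<^sup>*))"

text \<open>The forgetful map retaining the marked points \<open>i, j, k, l\<close>, with values in the moduli space of
  stable four-pointed curves, identified with the projective line by the cross ratio.\<close>

definition curve_cross_ratio :: "marked_curve \<Rightarrow> nat \<Rightarrow> nat \<Rightarrow> nat \<Rightarrow> nat \<Rightarrow> P1" where
  "curve_cross_ratio C i j k l = (THE w. \<exists>\<alpha>\<in>comps C.
     3 \<le> card (mark_on C \<alpha> ` {i, j, k, l}) \<and>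
     w = cross_ratio (mark_on C \<alpha> i) (mark_on C \<alpha> j) (mark_on C \<alpha> k) (mark_on C \<alpha> l))"

section \<open>The Deligne-Mumford-Knudsen moduli space and its class\<close>

text \<open>The map \<open>h\<close> to the projective line is finite near \<open>x\<close>, smooth, and \<open>J\<close>-holomorphic at \<open>x\<close> with
  differential \<open>D\<close>.\<close>

definition holomorphic_diff ::
  "rseq set \<Rightarrow> sc_struct \<Rightarrow> rseq \<Rightarrow> (rseq \<Rightarrow> P1) \<Rightarrow> (rseq \<Rightarrow> complex) \<Rightarrow> bool" where
  "holomorphic_diff M J x h D \<longleftrightarrow> (\<exists>U f. open U \<and> x \<in> U \<and> smooth_map (M \<inter> U) f \<and>
     (\<forall>y\<in>M \<inter> U. h y = Some (f y)) \<and> (f has_derivative D) (at x within M \<inter> U) \<and>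
     (\<forall>w\<in>tangent M x. D (fst (J x (w, 0))) = \<i> * D w))"

text \<open>\<open>(M, J)\<close> is the moduli space of stable genus-zero curves with \<open>n\<close> marked points, as a compact complex
  manifold of complex dimension \<open>n - 3\<close>: its points are the isomorphism classes of stable curves
  (\<open>C x\<close> is a representative of the class \<open>x\<close>), and the complex structure is the one for which the
  forgetful maps to the moduli spaces of four-pointed curves jointly form a holomorphic embedding.
  Since the points \<open>i, j, k, l\<close> can be reordered, it suffices to test the cross ratios where they are
  finite. \<open>M\<close> being compact and \<open>J\<close>-holomorphically embedded in a product of projective lines, \<open>J\<close> is integrable
  and \<open>(M, J)\<close> is unique up to biholomorphism.\<close>

definition is_Mbar :: "nat \<Rightarrow> rseq set \<Rightarrow> sc_struct \<Rightarrow> bool" where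
  "is_Mbar n M J \<longleftrightarrow> closed_scm (2 * (n - 3), M, 0, J) \<and> (\<exists>C.
     (\<forall>x\<in>M. stable_curve n (C x)) \<and>
     (\<forall>D. stable_curve n D \<longrightarrow> (\<exists>!x. x \<in> M \<and> curve_iso n (C x) D)) \<and>
     (\<forall>x\<in>M. \<forall>i<n. \<forall>j<n. \<forall>k<n. \<forall>l<n. distinct [i, j, k, l] \<longrightarrow>
        curve_cross_ratio (C x) i j k l \<noteq> None \<longrightarrow>
        (\<exists>D. holomorphic_diff M J x (\<lambda>y. curve_cross_ratio (C y) i j k l) D)) \<and>
     (\<forall>x\<in>M. \<forall>w\<in>tangent M x. w \<noteq> 0 \<longrightarrow> (\<exists>i<n. \<exists>j<n. \<exists>k<n. \<exists>l<n. distinct [i, j, k, l] \<and>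
        (\<exists>D. holomorphic_diff M J x (\<lambda>y. curve_cross_ratio (C y) i j k l) D \<and> D w \<noteq> 0))))"

text \<open>The class in \<open>MU^(-2(n-3))(pt)\<close> of the moduli space. The value \<open>0\<close> only
  makes the definition total: the moduli space is a compact complex manifold for all \<open>n\<close>
  (the empty one for \<open>n < 3\<close>).\<close>

definition Mbar_class :: "nat \<Rightarrow> mu" where
  "Mbar_class n = (if \<exists>M J. is_Mbar n M J
     then bordism_class (SOME X. \<exists>M J. is_Mbar n M J \<and> Rep_scm X = (2 * (n - 3), M, 0, J)) else 0)"

section \<open>The quantum product of a point\<close>

text \<open>For \<open>V = pt\<close> all the rings \<open>MU_\<Lambda>(V^m)\<close> are \<open>MU_\<Lambda>(pt)\<close>, external products are
  products, restriction to diagonals and the transfer of \<open>V \<rightarrow> pt\<close> are identities, the only degree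
  is \<open>\<alpha> = 0\<close>, and the moduli space of stable maps is the moduli space of stable curves.\<close>

abbreviation (input) dim_pt :: nat where "dim_pt \<equiv> 0"

definition transfer_pt :: "mu fls \<Rightarrow> mu fls" where
  "transfer_pt x = x"

definition trace_pt :: "mu fls \<Rightarrow> mu fls" where
  "trace_pt x = fls_X_intpow (int dim_pt) * transfer_pt x"

definition tau3_pt :: "mu fls" where
  "tau3_pt = fls_X_intpow (- 2 * int dim_pt) * divided_power_series (\<lambda>k. Mbar_class (3 + k))"

text \<open>\<open>x \<times> \<tau> \<times> y\<close> in \<open>MU_\<Lambda>(V^5)\<close>, to which \<open>b_V\<close>
  (restriction to the diagonal, then trace) is applied on two pairs of factors.\<close>

definition quantum_prod :: "mu fls \<Rightarrow> mu fls \<Rightarrow> mu fls" where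
  "quantum_prod x y = trace_pt (trace_pt (x * tau3_pt * y))"

definition coupling_constant :: "mu fls" where
  "coupling_constant = quantum_prod 1 1"

end

theory Submission
  imports Defs
begin

text \<open>The trace and the transfer of a point being identities, \<open>x * y\<close> is literally \<open>x \<tau> y\<close>
  for the series \<open>\<tau>\<close> of moduli spaces, so everything rests on two properties of the bordism
  ring: the point is a unit, and the moduli spaces are central. Both come from linear
  isomorphisms of products: the coordinate swap identifies \<open>X \<times> M\<close> with \<open>M \<times> X\<close> and, as \<open>M\<close> carries an
  unstabilised complex structure, also identifies their stable structures exactly. Stably
  complex manifolds with a linear isomorphism between them become bordant after one
  stabilisation, through a cylinder whose collar at one end is twisted by the isomorphism.\<close>

section \<open>Smooth maps\<close>

text \<open>\<open>cobordant\<close> speaks only of structures of positive rank: one coordinate of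
  R^(k+1) is traded for the normal direction of the collar. The point and the moduli spaces have
  rank 0, which is why a trivial complex line is added before any bordism is built and removed again
  inside the ideal. A complex structure of rank 0 lives on an even-dimensional manifold, so the swap
  meets no graded sign. The isomorphisms are restrictions of bounded linear maps of the ambient
  sequence space with bounded linear inverses. Such a map is its own derivative, so charts, tangent
  spaces and collars are transported by composing with linear or affine maps only. On the algebraic
  side \<open>mu\<close> is an additive group with a unit constant and a product, not an instance of
  a ring class, so the facts on Laurent series are derived from zero, unit and commutation
  identities of the coefficients alone.\<close>

lemma Ck_on_subset: "Ck_on k U f \<Longrightarrow> V \<subseteq> U \<Longrightarrow> Ck_on k V f"
  by (induction k arbitrary: f) (auto intro: continuous_on_subset)

text \<open>A derivative at a point of an open set depends only on nearby values, so agreement on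
  the set descends to every directional derivative. This lets the chosen
  \<open>frechet_derivative\<close> be replaced by an explicit formula.\<close>

lemma Ck_on_cong:
  assumes "Ck_on k U f" "open U" "\<And>x. x \<in> U \<Longrightarrow> f x = g x"
  shows "Ck_on k U g"
  using assms
proof (induction k arbitrary: f g)
  case 0
  then show ?case using continuous_on_cong[of U U f g] by simp
next
  case (Suc k)
  have diff: "f differentiable (at x)" if "x \<in> U" for x
    using Suc.prems(1) that by simp
  have "g differentiable (at x)" if "x \<in> U" for x
    using diff[OF that] Suc.prems(2,3) that
    by (meson differentiable_def has_derivative_transform_within_open)
  moreover have "Ck_on k U (\<lambda>x. frechet_derivative g (at x) v)" for v
  proof (rule Suc.IH)
    show "Ck_on k U (\<lambda>x. frechet_derivative f (at x) v)" using Suc.prems(1) by simp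
    show "frechet_derivative f (at x) v = frechet_derivative g (at x) v" if "x \<in> U" for x
      using frechet_derivative_transform_within_open[OF diff[OF that] Suc.prems(2) that] Suc.prems(3)
      by simp
  qed fact
  ultimately show ?case by simp
qed

text \<open>The derivative is evaluated at a fixed vector in \<^const>\<open>Ck_on\<close>, so composition with affine
  maps is elementary, whereas general composition would need uniform boundedness.\<close>

lemma Ck_on_SucI:
  assumes "\<And>x. x \<in> U \<Longrightarrow> (f has_derivative f' x) (at x)" "open U" "\<And>v. Ck_on k U (\<lambda>x. f' x v)"
  shows "Ck_on (Suc k) U f"
proof -
  have "Ck_on k U (\<lambda>x. frechet_derivative f (at x) v)" for v
  proof (rule Ck_on_cong[OF assms(3,2)])
    show "f' x v = frechet_derivative f (at x) v" if "x \<in> U" for x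
      by (simp only: frechet_derivative_at[OF assms(1)[OF that]])
  qed
  moreover have "f differentiable (at x)" if "x \<in> U" for x
    using assms(1)[OF that] by (rule differentiableI)
  ultimately show ?thesis by simp
qed

lemma Ck_on_derivative:
  "Ck_on (Suc k) U f \<Longrightarrow> x \<in> U \<Longrightarrow> (f has_derivative frechet_derivative f (at x)) (at x)"
  by (simp add: frechet_derivative_works[symmetric])

lemma Ck_on_const: "open U \<Longrightarrow> Ck_on k U (\<lambda>x. c)"
proof (induction k arbitrary: c)
  case (Suc k)
  show ?case by (rule Ck_on_SucI[OF has_derivative_const Suc.prems]) (rule Suc.IH[OF Suc.prems])
qed simp

lemma has_derivative_affine:
  "bounded_linear L \<Longrightarrow> ((\<lambda>x. L x + c) has_derivative L) F"
  using has_derivative_add_const[OF bounded_linear_imp_has_derivative] .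

lemma continuous_on_affine: "bounded_linear L \<Longrightarrow> continuous_on U (\<lambda>x. L x + c)"
  by (intro continuous_intros linear_continuous_on)

lemma Ck_on_affine: "bounded_linear L \<Longrightarrow> open U \<Longrightarrow> Ck_on k U (\<lambda>x. L x + c)"
  by (cases k) (auto simp: continuous_on_affine simp del: Ck_on.simps(2)
      intro!: Ck_on_SucI[where f' = "\<lambda>_. L"] has_derivative_affine Ck_on_const)

lemma open_vimage_affine:
  "bounded_linear L \<Longrightarrow> open U \<Longrightarrow> open ((\<lambda>x. L x + c) -` U)"
  using continuous_on_affine[of L UNIV c] by (simp add: open_vimage)

text \<open>By the chain rule the derivative of the composite in direction v is the derivative of f
  in the fixed direction \<open>L v\<close>, again composed with the same affine map. The induction
  hypothesis therefore applies to that derivative.\<close>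

lemma Ck_on_compose_affine:
  assumes "bounded_linear L" "open U" "Ck_on k U f"
  shows "Ck_on k ((\<lambda>x. L x + c) -` U) (\<lambda>x. f (L x + c))"
  using assms(3)
proof (induction k arbitrary: f)
  case 0
  then have "continuous_on ((\<lambda>x. L x + c) -` U) (f \<circ> (\<lambda>x. L x + c))"
    using assms(1) by (intro continuous_on_compose continuous_on_affine) (auto intro: continuous_on_subset)
  then show ?case by (simp add: o_def)
next
  case (Suc k)
  show ?case
  proof (rule Ck_on_SucI)
    show "((\<lambda>x. f (L x + c)) has_derivative (\<lambda>v. frechet_derivative f (at (L x + c)) (L v))) (at x)"
      if "x \<in> (\<lambda>x. L x + c) -` U" for x
      using has_derivative_compose[OF has_derivative_affine[OF assms(1)] Ck_on_derivative[OF Suc.prems]] that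
      by simp
    show "Ck_on k ((\<lambda>x. L x + c) -` U) (\<lambda>x. frechet_derivative f (at (L x + c)) (L v))" for v
      by (rule Suc.IH) (use Suc.prems in simp)
  qed (rule open_vimage_affine[OF assms(1,2)])
qed

lemma Ck_on_linear:
  assumes "bounded_linear L" "open U" "Ck_on k U f"
  shows "Ck_on k U (\<lambda>x. L (f x))"
  using assms(3)
proof (induction k arbitrary: f)
  case 0
  then show ?case using bounded_linear.continuous_on[OF assms(1)] by simp
next
  case (Suc k)
  show ?case
  proof (rule Ck_on_SucI)
    show "((\<lambda>x. L (f x)) has_derivative (\<lambda>v. L (frechet_derivative f (at x) v))) (at x)" if "x \<in> U" for x
      by (rule bounded_linear.has_derivative[OF assms(1) Ck_on_derivative[OF Suc.prems that]])
    show "Ck_on k U (\<lambda>x. L (frechet_derivative f (at x) v))" for v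
      by (rule Suc.IH) (use Suc.prems in simp)
  qed fact
qed

lemma Ck_on_Pair:
  assumes "open U" "Ck_on k U f" "Ck_on k U g"
  shows "Ck_on k U (\<lambda>x. (f x, g x))"
  using assms(2,3)
proof (induction k arbitrary: f g)
  case 0
  then show ?case by (simp add: continuous_on_Pair)
next
  case (Suc k)
  show ?case
  proof (rule Ck_on_SucI)
    show "((\<lambda>x. (f x, g x)) has_derivative
        (\<lambda>v. (frechet_derivative f (at x) v, frechet_derivative g (at x) v))) (at x)" if "x \<in> U" for x
      by (intro has_derivative_Pair Ck_on_derivative[OF _ that]) fact+
    show "Ck_on k U (\<lambda>x. (frechet_derivative f (at x) v, frechet_derivative g (at x) v))" for v
      by (rule Suc.IH) (use Suc.prems in simp_all)
  qed fact
qed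

section \<open>Smooth maps on arbitrary subsets, and diffeomorphisms\<close>

lemma smooth_mapI:
  assumes "\<And>x. x \<in> A \<Longrightarrow> \<exists>U g. open U \<and> x \<in> U \<and> (\<forall>k. Ck_on k U g) \<and> (\<forall>y\<in>A \<inter> U. f y = g y)"
  shows "smooth_map A f"
  using assms by (simp add: smooth_map_def)

lemma smooth_mapE:
  assumes "smooth_map A f" "x \<in> A"
  obtains U g where "open U" "x \<in> U" "\<And>k. Ck_on k U g" "\<And>y. y \<in> A \<Longrightarrow> y \<in> U \<Longrightarrow> f y = g y"
  using assms by (fastforce simp: smooth_map_def)

lemma smooth_map_cong: "smooth_map A f \<Longrightarrow> (\<And>x. x \<in> A \<Longrightarrow> f x = g x) \<Longrightarrow> smooth_map A g"
  by (simp add: smooth_map_def)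

lemma smooth_map_affine: "bounded_linear L \<Longrightarrow> smooth_map A (\<lambda>x. L x + c)"
  by (rule smooth_mapI, intro exI[of _ UNIV] exI[of _ "\<lambda>x. L x + c"]) (simp add: Ck_on_affine)

lemma smooth_map_bounded_linear: "bounded_linear L \<Longrightarrow> smooth_map A L"
  using smooth_map_affine[of L A 0] by simp

lemma smooth_map_compose_affine:
  assumes f: "smooth_map A f" and L: "bounded_linear L" and B: "\<And>x. x \<in> B \<Longrightarrow> L x + c \<in> A"
  shows "smooth_map B (\<lambda>x. f (L x + c))"
proof (rule smooth_mapI)
  fix x assume x: "x \<in> B"
  obtain U g where "open U" "L x + c \<in> U" "\<And>k. Ck_on k U g" "\<And>y. y \<in> A \<Longrightarrow> y \<in> U \<Longrightarrow> f y = g y"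
    using smooth_mapE[OF f B[OF x]] by blast
  note Ug = this
  show "\<exists>U g. open U \<and> x \<in> U \<and> (\<forall>k. Ck_on k U g) \<and> (\<forall>y\<in>B \<inter> U. f (L y + c) = g y)"
  proof (intro exI conjI allI)
    show "open ((\<lambda>x. L x + c) -` U)" by (rule open_vimage_affine[OF L Ug(1)])
    show "Ck_on k ((\<lambda>x. L x + c) -` U) (\<lambda>x. g (L x + c))" for k
      by (rule Ck_on_compose_affine[OF L Ug(1,3)])
  qed (use Ug B in auto)
qed

lemma smooth_map_compose_bounded_linear:
  "smooth_map A f \<Longrightarrow> bounded_linear L \<Longrightarrow> (\<And>x. x \<in> B \<Longrightarrow> L x \<in> A) \<Longrightarrow> smooth_map B (\<lambda>x. f (L x))"
  using smooth_map_compose_affine[of A f L B 0] by simp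

lemma smooth_map_linear:
  assumes "smooth_map A f" "bounded_linear L"
  shows "smooth_map A (\<lambda>x. L (f x))"
proof (rule smooth_mapI)
  fix x assume x: "x \<in> A"
  obtain U g
    where "open U" "x \<in> U" "\<And>k. Ck_on k U g" "\<And>y. y \<in> A \<Longrightarrow> y \<in> U \<Longrightarrow> f y = g y"
    using smooth_mapE[OF assms(1) x] by blast
  note Ug = this
  show "\<exists>U g. open U \<and> x \<in> U \<and> (\<forall>k. Ck_on k U g) \<and> (\<forall>y\<in>A \<inter> U. L (f y) = g y)"
  proof (intro exI conjI allI)
    show "Ck_on k U (\<lambda>x. L (g x))" for k by (rule Ck_on_linear[OF assms(2) Ug(1,3)])
  qed (use Ug in auto)
qed

lemma smooth_map_Pair:
  assumes "smooth_map A f" "smooth_map A g"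
  shows "smooth_map A (\<lambda>x. (f x, g x))"
proof (rule smooth_mapI)
  fix x assume x: "x \<in> A"
  obtain U f'
    where f: "open U" "x \<in> U" "\<And>k. Ck_on k U f'" "\<And>y. y \<in> A \<Longrightarrow> y \<in> U \<Longrightarrow> f y = f' y"
    using smooth_mapE[OF assms(1) x] by blast
  obtain V g'
    where g: "open V" "x \<in> V" "\<And>k. Ck_on k V g'" "\<And>y. y \<in> A \<Longrightarrow> y \<in> V \<Longrightarrow> g y = g' y"
    using smooth_mapE[OF assms(2) x] by blast
  show "\<exists>U h. open U \<and> x \<in> U \<and> (\<forall>k. Ck_on k U h) \<and> (\<forall>y\<in>A \<inter> U. (f y, g y) = h y)"
  proof (intro exI conjI allI)
    show open_UV: "open (U \<inter> V)" using f(1) g(1) by (rule open_Int)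
    show "Ck_on k (U \<inter> V) (\<lambda>x. (f' x, g' x))" for k
      by (rule Ck_on_Pair[OF open_UV]; rule Ck_on_subset) (use f(3) g(3) in auto)
  qed (use f g in auto)
qed

text \<open>Any explicit inverse agrees with \<open>the_inv_into\<close> on B, and smoothness on B
  sees only values there. Charts and collars can thus be given by formulas in both
  directions.\<close>

lemma diffeoI:
  assumes "smooth_map A f" "smooth_map B g" "\<And>x. x \<in> A \<Longrightarrow> f x \<in> B" "\<And>y. y \<in> B \<Longrightarrow> g y \<in> A"
    "\<And>x. x \<in> A \<Longrightarrow> g (f x) = x" "\<And>y. y \<in> B \<Longrightarrow> f (g y) = y"
  shows "diffeo A B f"
proof -
  have bij: "bij_betw f A B"
    using assms by (intro bij_betwI[where g = g]) auto
  then have "g y = the_inv_into A f y" if "y \<in> B" for y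
    using assms that by (metis bij_betw_imp_inj_on the_inv_into_f_f)
  with smooth_map_cong[OF assms(2)] bij assms(1) show ?thesis
    by (simp add: diffeo_def)
qed

lemma diffeoE:
  assumes "diffeo A B f"
  obtains g where "smooth_map A f" "smooth_map B g" "\<And>x. x \<in> A \<Longrightarrow> f x \<in> B" "\<And>y. y \<in> B \<Longrightarrow> g y \<in> A"
    "\<And>x. x \<in> A \<Longrightarrow> g (f x) = x" "\<And>y. y \<in> B \<Longrightarrow> f (g y) = y"
proof
  have bij: "bij_betw f A B" using assms by (simp add: diffeo_def)
  show "smooth_map A f" "smooth_map B (the_inv_into A f)" using assms by (auto simp: diffeo_def)
  show "f x \<in> B" if "x \<in> A" for x using bij that by (auto simp: bij_betw_def)
  show "the_inv_into A f y \<in> A" if "y \<in> B" for y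
    using bij that by (auto simp: bij_betw_def the_inv_into_into)
  show "the_inv_into A f (f x) = x" if "x \<in> A" for x
    using bij that by (auto simp: bij_betw_def the_inv_into_f_f)
  show "f (the_inv_into A f y) = y" if "y \<in> B" for y
    using bij that by (auto simp: bij_betw_def f_the_inv_into_f)
qed

section \<open>Linear maps between sequence spaces\<close>

lemmas seq_apply = seq_cons.rep_eq seq_take.rep_eq seq_drop.rep_eq seq_append.rep_eq interleave.rep_eq
  seq_evens.rep_eq seq_odds.rep_eq plus_bcontfun.rep_eq scaleR_bcontfun.rep_eq zero_bcontfun.rep_eq
  uminus_bcontfun.rep_eq

text \<open>The norm of \<open>rseq\<close> is the supremum norm, so coordinatewise estimates
  suffice. The operations below only move, delete or merge coordinates, which gives the constant 1
  for all of them.\<close>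

lemma bounded_linear_rseqI:
  fixes f :: "'a::real_normed_vector \<Rightarrow> rseq"
  assumes "\<And>x y i. apply_bcontfun (f (x + y)) i = apply_bcontfun (f x) i + apply_bcontfun (f y) i"
    and "\<And>r x i. apply_bcontfun (f (r *\<^sub>R x)) i = r * apply_bcontfun (f x) i"
    and "\<And>x i. \<bar>apply_bcontfun (f x) i\<bar> \<le> norm x"
  shows "bounded_linear f"
proof (rule bounded_linear_intro[where K = 1])
  show "f (x + y) = f x + f y" for x y by (rule bcontfun_eqI) (simp add: assms seq_apply)
  show "f (r *\<^sub>R x) = r *\<^sub>R f x" for r x by (rule bcontfun_eqI) (simp add: assms seq_apply)
  show "norm (f x) \<le> norm x * 1" for x using norm_bound[of "f x" "norm x"] assms(3) by simp
qed

lemma bounded_linear_apply_bcontfun: "bounded_linear (\<lambda>x :: rseq. apply_bcontfun x i)"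
  by (rule bounded_linear_intro[where K = 1]) (auto simp: seq_apply rseq_bound)

lemma rseq_bound_fst: "\<bar>apply_bcontfun (fst z :: rseq) i\<bar> \<le> norm z"
  using rseq_bound[of "fst z" i] norm_fst_le[of "fst z" "snd z"] by simp

lemma rseq_bound_snd: "\<bar>apply_bcontfun (snd z :: rseq) i\<bar> \<le> norm z"
  using rseq_bound[of "snd z" i] norm_snd_le[of "snd z" "fst z"] by simp

lemma bounded_linear_seq_take: "bounded_linear (seq_take k)"
  by (rule bounded_linear_rseqI) (auto simp: seq_apply rseq_bound)

lemma bounded_linear_seq_drop: "bounded_linear (seq_drop k)"
  by (rule bounded_linear_rseqI) (auto simp: seq_apply rseq_bound)

lemma bounded_linear_seq_evens: "bounded_linear seq_evens"
  by (rule bounded_linear_rseqI) (auto simp: seq_apply rseq_bound)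

lemma bounded_linear_seq_odds: "bounded_linear seq_odds"
  by (rule bounded_linear_rseqI) (auto simp: seq_apply rseq_bound)

lemma bounded_linear_seq_cons: "bounded_linear (\<lambda>z. seq_cons (fst z) (snd z))"
proof (rule bounded_linear_rseqI)
  show "\<bar>apply_bcontfun (seq_cons (fst z) (snd z)) i\<bar> \<le> norm z" for z i
    using norm_fst_le[of "fst z" "snd z"] rseq_bound_snd[of z]
    by (cases i) (simp_all add: seq_apply)
qed (auto simp: seq_apply split: nat.split)

lemma bounded_linear_seq_append: "bounded_linear (\<lambda>z. seq_append k (fst z) (snd z))"
  by (rule bounded_linear_rseqI) (auto simp: seq_apply rseq_bound_fst rseq_bound_snd)

lemma bounded_linear_interleave: "bounded_linear (\<lambda>z. interleave (fst z) (snd z))"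
  by (rule bounded_linear_rseqI) (auto simp: seq_apply rseq_bound_fst rseq_bound_snd)

lemma bounded_linear_compose2:
  assumes "bounded_linear (\<lambda>z. h (fst z) (snd z))" "bounded_linear f" "bounded_linear g"
  shows "bounded_linear (\<lambda>x. h (f x) (g x))"
  using bounded_linear_compose[OF assms(1) bounded_linear_Pair[OF assms(2,3)]] by simp

text \<open>Operations appear bare and in composed form: \<open>intro\<close> peels a nested term
  from the outside with the composed rules and ends with a bare one.\<close>

lemmas bounded_linear_seq_intros =
  bounded_linear_Pair bounded_linear_ident bounded_linear_zero
  bounded_linear_fst bounded_linear_snd
  bounded_linear_apply_bcontfun bounded_linear_seq_take bounded_linear_seq_drop
  bounded_linear_seq_evens bounded_linear_seq_odds bounded_linear_minus
  bounded_linear_compose[OF bounded_linear_fst] bounded_linear_compose[OF bounded_linear_snd]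
  bounded_linear_compose[OF bounded_linear_apply_bcontfun]
  bounded_linear_compose[OF bounded_linear_seq_take]
  bounded_linear_compose[OF bounded_linear_seq_drop]
  bounded_linear_compose[OF bounded_linear_seq_evens]
  bounded_linear_compose[OF bounded_linear_seq_odds]
  bounded_linear_compose2[OF bounded_linear_seq_cons]
  bounded_linear_compose2[OF bounded_linear_seq_append]
  bounded_linear_compose2[OF bounded_linear_interleave]

section \<open>Identities for cutting, joining and interleaving sequences\<close>

lemma seq_evens_interleave [simp]: "seq_evens (interleave x y) = x"
  by (rule bcontfun_eqI) (simp add: seq_apply)

lemma seq_odds_interleave [simp]: "seq_odds (interleave x y) = y"
  by (rule bcontfun_eqI) (simp add: seq_apply)

lemma interleave_evens_odds [simp]: "interleave (seq_evens x) (seq_odds x) = x"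
  by (rule bcontfun_eqI) (simp add: seq_apply odd_two_times_div_two_succ)

lemma seq_append_take_drop [simp]: "seq_append k (seq_take k x) (seq_drop k x) = x"
  by (rule bcontfun_eqI) (simp add: seq_apply)

lemma seq_drop_append [simp]: "seq_drop k (seq_append k x y) = y"
  by (rule bcontfun_eqI) (simp add: seq_apply)

lemma seq_take_append [simp]: "x \<in> Rn k \<Longrightarrow> seq_take k (seq_append k x y) = x"
  by (rule bcontfun_eqI) (simp add: seq_apply Rn_def)

lemma seq_drop_cons [simp]: "seq_drop (Suc 0) (seq_cons s x) = x"
  by (rule bcontfun_eqI) (simp add: seq_apply)

lemma seq_cons_0_drop [simp]: "seq_cons (apply_bcontfun x 0) (seq_drop (Suc 0) x) = x"
  by (rule bcontfun_eqI) (simp add: seq_apply split: nat.split)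

lemma seq_cons_0 [simp]: "apply_bcontfun (seq_cons s x) 0 = s"
  by (simp add: seq_apply)

lemma seq_take_Rn [simp]: "seq_take k x \<in> Rn k"
  by (simp add: Rn_def seq_apply)

lemma seq_take_id: "x \<in> Rn k \<Longrightarrow> seq_take k x = x"
  by (rule bcontfun_eqI) (simp add: seq_apply Rn_def)

lemma seq_drop_Rn: "x \<in> Rn (k + l) \<Longrightarrow> seq_drop k x \<in> Rn l"
  by (simp add: Rn_def seq_apply)

lemma seq_drop_Rn_0: "x \<in> Rn k \<Longrightarrow> seq_drop k x = 0"
  by (rule bcontfun_eqI) (simp add: seq_apply Rn_def)

lemma seq_append_Rn: "x \<in> Rn k \<Longrightarrow> y \<in> Rn l \<Longrightarrow> seq_append k x y \<in> Rn (k + l)"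
  by (simp add: Rn_def seq_apply)

lemma seq_append_0 [simp]: "seq_append 0 x y = y"
  by (rule bcontfun_eqI) (simp add: seq_apply)

lemma seq_append_0_right: "x \<in> Rn k \<Longrightarrow> seq_append k x 0 = x"
  by (rule bcontfun_eqI) (simp add: seq_apply Rn_def)

lemma seq_take_0 [simp]: "seq_take 0 x = 0"
  by (rule bcontfun_eqI) (simp add: seq_apply)

lemma seq_drop_0 [simp]: "seq_drop 0 x = x"
  by (rule bcontfun_eqI) (simp add: seq_apply)

text \<open>This is the splitting of R^(k+2) into R^k and R^2 along which \<open>stab_struct\<close>
  acts: J on the first k coordinates, a quarter turn on the last two.\<close>

lemma seq_append_take_two:
  assumes "x \<in> Rn (k + 2)"
  shows "seq_append k (seq_take k x) (seq_cons (apply_bcontfun x k) (seq_cons (apply_bcontfun x (k + 1)) 0)) = x"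
proof (rule bcontfun_eqI)
  fix i
  have tail: "apply_bcontfun x (k + Suc (Suc m)) = 0" for m
    using assms by (simp add: Rn_def)
  consider "i < k" | "i = k" | "i = k + 1" | m where "i = k + Suc (Suc m)"
    by (metis One_nat_def add_0_right less_imp_add_positive linorder_neqE_nat not0_implies_Suc)
  then show "apply_bcontfun (seq_append k (seq_take k x)
      (seq_cons (apply_bcontfun x k) (seq_cons (apply_bcontfun x (k + 1)) 0))) i = apply_bcontfun x i"
    by cases (use tail in \<open>simp_all add: seq_apply\<close>)
qed

lemma seq_cons_Rn: "x \<in> Rn k \<Longrightarrow> seq_cons s x \<in> Rn (Suc k)"
  by (auto simp: Rn_def seq_apply split: nat.split)

lemma Rn_0 [simp]: "Rn 0 = {0}"
  by (auto simp: Rn_def seq_apply intro: bcontfun_eqI)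

lemma zero_in_Rn [simp]: "0 \<in> Rn k"
  by (simp add: Rn_def seq_apply)

section \<open>Tangent spaces and manifolds\<close>

text \<open>Curves in A are carried to curves in B and their velocities by L; linearity extends this
  from velocities to their span. The constant c allows slices of a product to be reached.\<close>

lemma tangent_affine_image:
  assumes L: "bounded_linear L" and AB: "\<And>y. y \<in> A \<Longrightarrow> L y + c \<in> B" and w: "w \<in> tangent A x"
  shows "L w \<in> tangent B (L x + c)"
proof -
  let ?V = "\<lambda>A x. {w. \<exists>\<gamma>. \<gamma> 0 = x \<and> (\<forall>t\<ge>0. \<gamma> t \<in> A) \<and>
     (\<gamma> has_vector_derivative w) (at 0 within {0::real..})}"
  have "L ` ?V A x \<subseteq> ?V B (L x + c)"
  proof (rule image_subsetI, safe)
    fix w \<gamma>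
    assume \<gamma>: "x = \<gamma> 0" "\<forall>t\<ge>0. \<gamma> t \<in> A" "(\<gamma> has_vector_derivative w) (at 0 within {0::real..})"
    have "((\<lambda>t. L (\<gamma> t) + c) has_vector_derivative L w) (at 0 within {0..})"
      by (simp add: has_vector_derivative_add_const bounded_linear.has_vector_derivative[OF L \<gamma>(3)])
    with \<gamma>(2) AB show "\<exists>\<delta>. \<delta> 0 = L (\<gamma> 0) + c \<and> (\<forall>t\<ge>0. \<delta> t \<in> B) \<and>
        (\<delta> has_vector_derivative L w) (at 0 within {0..})"
      by (intro exI[of _ "\<lambda>t. L (\<gamma> t) + c"]) simp
  qed
  from span_mono[OF this] have "L ` span (?V A x) \<subseteq> span (?V B (L x + c))"
    by (simp only: linear_span_image[OF bounded_linear.linear[OF L]])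
  with w show ?thesis unfolding tangent_def by blast
qed

lemma tangent_linear_image:
  "bounded_linear L \<Longrightarrow> (\<And>y. y \<in> A \<Longrightarrow> L y \<in> B) \<Longrightarrow> w \<in> tangent A x \<Longrightarrow> L w \<in> tangent B (L x)"
  using tangent_affine_image[of L A 0 B w x] by simp

text \<open>The projections give one inclusion. For the other, each factor is included as the slice
  through the other point, an affine map, and the two resulting vectors are added inside the
  span.\<close>

lemma tangent_Times:
  assumes "x \<in> A" "y \<in> B"
  shows "tangent (A \<times> B) (x, y) = tangent A x \<times> tangent B y"
proof (intro equalityI subsetI)
  fix w assume w: "w \<in> tangent (A \<times> B) (x, y)"
  have "fst w \<in> tangent A (fst (x, y))"
    by (rule tangent_linear_image[OF bounded_linear_fst _ w]) auto
  moreover have "snd w \<in> tangent B (snd (x, y))"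
    by (rule tangent_linear_image[OF bounded_linear_snd _ w]) auto
  ultimately show "w \<in> tangent A x \<times> tangent B y" by (simp add: mem_Times_iff)
next
  fix w assume w: "w \<in> tangent A x \<times> tangent B y"
  have "(fst w, 0) \<in> tangent (A \<times> B) ((x, 0) + (0, y))"
    by (rule tangent_affine_image[where L = "\<lambda>u. (u, 0)" and A = A])
      (use assms w in \<open>auto intro: bounded_linear_seq_intros\<close>)
  moreover have "(0, snd w) \<in> tangent (A \<times> B) ((0, y) + (x, 0))"
    by (rule tangent_affine_image[where L = "\<lambda>u. (0, u)" and A = B])
      (use assms w in \<open>auto intro: bounded_linear_seq_intros\<close>)
  ultimately have "(fst w, 0) + (0, snd w) \<in> tangent (A \<times> B) (x, y)"
    unfolding tangent_def by (intro span_add) simp_all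
  then show "w \<in> tangent (A \<times> B) (x, y)" by simp
qed

lemma tangent_UNIV_real: "tangent (UNIV :: real set) t = UNIV"
proof -
  have "w \<in> tangent UNIV t" for w
    unfolding tangent_def
    by (intro span_base CollectI exI[of _ "\<lambda>s. t + s * w"])
      (auto intro!: derivative_eq_intros simp: has_real_derivative_iff_has_vector_derivative[symmetric])
  then show ?thesis by blast
qed

lemma tangent_singleton: "tangent {a} a = {0}"
proof -
  have "w = 0"
    if \<gamma>: "\<forall>t\<ge>0. \<gamma> t = a" "(\<gamma> has_vector_derivative w) (at 0 within {0::real..})" for \<gamma> w
  proof -
    have "((\<lambda>_. a) has_vector_derivative w) (at 0 within {0::real..})"
      by (rule has_vector_derivative_transform[OF _ _ \<gamma>(2)]) (use \<gamma>(1) in auto)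
    \<comment> \<open>The curve is constant only on the half-line, so uniqueness of the derivative
      rests on 0 being a limit point of that half-line.\<close>
    moreover have "at 0 within {0::real..} \<noteq> bot"
    proof -
      have "{0::real..} - {0} = {0<..}" by auto
      then show ?thesis by (simp add: at_within_eq_bot_iff)
    qed
    ultimately show ?thesis
      using vector_derivative_unique_within has_vector_derivative_const by blast
  qed
  then have "span {w. \<exists>\<gamma>. \<gamma> 0 = a \<and> (\<forall>t\<ge>0. \<gamma> t \<in> {a}) \<and>
      (\<gamma> has_vector_derivative w) (at 0 within {0::real..})} \<subseteq> span {0}"
    by (intro span_mono) auto
  moreover have "0 \<in> tangent {a} a" by (simp add: tangent_def span_zero)
  ultimately show ?thesis unfolding tangent_def by auto
qed

section \<open>Charts: linear images, products, the line and the point\<close>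

lemma manifoldE:
  assumes "manifold d M" "x \<in> M"
  obtains U V \<phi> where "openin (top_of_set M) U" "x \<in> U" "openin (top_of_set (Rn d)) V" "diffeo V U \<phi>"
  using assms unfolding manifold_def by blast

lemma openin_linear_image:
  assumes "bounded_linear K" "\<And>x. x \<in> M \<Longrightarrow> K (L x) = x" "openin (top_of_set M) U"
  shows "openin (top_of_set (L ` M)) (L ` U)"
proof -
  obtain O' where O': "open O'" "U = M \<inter> O'" using assms(3) by (auto simp: openin_open)
  have "open (K -` O')" using open_vimage_affine[OF assms(1) O'(1), of 0] by simp
  moreover have "L ` U = L ` M \<inter> K -` O'" using assms(2) O'(2) by force
  ultimately show ?thesis by (auto simp: openin_open)
qed

text \<open>A chart of M followed by L is a chart of the image; its inverse first applies K, which
  is smooth because it is linear on the ambient space.\<close>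

lemma manifold_linear_image:
  assumes L: "bounded_linear L" and K: "bounded_linear K" and KL: "\<And>x. x \<in> M \<Longrightarrow> K (L x) = x"
    and M: "manifold d M"
  shows "manifold d (L ` M)"
  unfolding manifold_def
proof
  fix y assume "y \<in> L ` M"
  then obtain x where x: "x \<in> M" "y = L x" by blast
  obtain U V \<phi> where *: "openin (top_of_set M) U" "x \<in> U" "openin (top_of_set (Rn d)) V" "diffeo V U \<phi>"
    by (rule manifoldE[OF M x(1)])
  obtain \<psi> where \<phi>\<psi>: "smooth_map V \<phi>" "smooth_map U \<psi>" "\<And>x. x \<in> V \<Longrightarrow> \<phi> x \<in> U" "\<And>y. y \<in> U \<Longrightarrow> \<psi> y \<in> V"
    "\<And>x. x \<in> V \<Longrightarrow> \<psi> (\<phi> x) = x" "\<And>y. y \<in> U \<Longrightarrow> \<phi> (\<psi> y) = y" by (rule diffeoE[OF *(4)]) blast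
  have KU: "K (L u) = u" if "u \<in> U" for u
    using KL that *(1) by (meson in_mono openin_imp_subset)
  have "diffeo V (L ` U) (\<lambda>z. L (\<phi> z))"
  proof (rule diffeoI)
    show "smooth_map V (\<lambda>z. L (\<phi> z))" by (rule smooth_map_linear[OF \<phi>\<psi>(1) L])
    show "smooth_map (L ` U) (\<lambda>y. \<psi> (K y))"
      by (rule smooth_map_compose_bounded_linear[OF \<phi>\<psi>(2) K]) (use KU in auto)
  qed (use \<phi>\<psi>(3-6) KU in auto)
  moreover have "openin (top_of_set (L ` M)) (L ` U)"
    by (rule openin_linear_image[OF K KL *(1)])
  ultimately show "\<exists>U V \<phi>. openin (top_of_set (L ` M)) U \<and> y \<in> U \<and> openin (top_of_set (Rn d)) V \<and> diffeo V U \<phi>"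
    using *(2,3) x(2) by blast
qed

lemma manifold_Times:
  assumes "manifold d M" "manifold e N"
  shows "manifold (d + e) (M \<times> N)"
  unfolding manifold_def
proof (clarify)
  fix x y assume x: "x \<in> M" and y: "y \<in> N"
  obtain U V \<phi> where *: "openin (top_of_set M) U" "x \<in> U" "openin (top_of_set (Rn d)) V" "diffeo V U \<phi>"
    by (rule manifoldE[OF assms(1) x])
  obtain U' V' \<phi>' where **: "openin (top_of_set N) U'" "y \<in> U'" "openin (top_of_set (Rn e)) V'"
    "diffeo V' U' \<phi>'" by (rule manifoldE[OF assms(2) y])
  obtain \<psi> where \<phi>: "smooth_map V \<phi>" and \<psi>: "smooth_map U \<psi>"
    and \<phi>\<psi>: "\<And>x. x \<in> V \<Longrightarrow> \<phi> x \<in> U" "\<And>y. y \<in> U \<Longrightarrow> \<psi> y \<in> V"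
    "\<And>x. x \<in> V \<Longrightarrow> \<psi> (\<phi> x) = x" "\<And>y. y \<in> U \<Longrightarrow> \<phi> (\<psi> y) = y" by (rule diffeoE[OF *(4)]) blast
  obtain \<psi>' where \<phi>': "smooth_map V' \<phi>'" and \<psi>': "smooth_map U' \<psi>'"
    and \<phi>\<psi>': "\<And>x. x \<in> V' \<Longrightarrow> \<phi>' x \<in> U'" "\<And>y. y \<in> U' \<Longrightarrow> \<psi>' y \<in> V'"
    "\<And>x. x \<in> V' \<Longrightarrow> \<psi>' (\<phi>' x) = x" "\<And>y. y \<in> U' \<Longrightarrow> \<phi>' (\<psi>' y) = y" by (rule diffeoE[OF **(4)]) blast
  have V: "V \<subseteq> Rn d" "V' \<subseteq> Rn e" using *(3) **(3) by (simp_all add: openin_imp_subset)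
  \<comment> \<open>A chart must be parametrised by a set of single sequences in
    \<open>Rn (d + e)\<close>, so the product of V and V' is re-encoded by joining at position
    d.\<close>
  define Z where "Z = {z \<in> Rn (d + e). seq_take d z \<in> V \<and> seq_drop d z \<in> V'}"
  have "openin (top_of_set (Rn (d + e))) Z"
  proof -
    obtain O1 O2 where O: "open O1" "V = Rn d \<inter> O1" "open O2" "V' = Rn e \<inter> O2"
      using *(3) **(3) by (auto simp: openin_open)
    have "open (seq_take d -` O1 \<inter> seq_drop d -` O2)"
      using open_vimage_affine[OF bounded_linear_seq_take O(1), of d 0]
        open_vimage_affine[OF bounded_linear_seq_drop O(3), of d 0] by (intro open_Int) simp_all
    moreover have "Z = Rn (d + e) \<inter> (seq_take d -` O1 \<inter> seq_drop d -` O2)"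
      using O by (auto simp: Z_def seq_drop_Rn)
    ultimately show ?thesis by (auto simp: openin_open)
  qed
  moreover have "diffeo Z (U \<times> U') (\<lambda>z. (\<phi> (seq_take d z), \<phi>' (seq_drop d z)))"
  proof (rule diffeoI)
    show "smooth_map Z (\<lambda>z. (\<phi> (seq_take d z), \<phi>' (seq_drop d z)))"
      by (intro smooth_map_Pair smooth_map_compose_bounded_linear[OF \<phi>]
          smooth_map_compose_bounded_linear[OF \<phi>'] bounded_linear_seq_intros) (auto simp: Z_def)
    have "smooth_map (U \<times> U') (\<lambda>p. (\<psi> (fst p), \<psi>' (snd p)))"
      by (intro smooth_map_Pair smooth_map_compose_bounded_linear[OF \<psi>]
          smooth_map_compose_bounded_linear[OF \<psi>'] bounded_linear_seq_intros) auto
    from smooth_map_linear[OF this bounded_linear_seq_append]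
    show "smooth_map (U \<times> U') (\<lambda>p. seq_append d (\<psi> (fst p)) (\<psi>' (snd p)))" by simp
  qed (use \<phi>\<psi> \<phi>\<psi>' V in \<open>auto simp: Z_def subset_iff seq_append_Rn\<close>)
  moreover have "openin (top_of_set (M \<times> N)) (U \<times> U')"
    using *(1) **(1) by (rule openin_Times)
  ultimately show "\<exists>W V \<phi>. openin (top_of_set (M \<times> N)) W \<and> (x, y) \<in> W \<and>
      openin (top_of_set (Rn (d + e))) V \<and> diffeo V W \<phi>"
    using *(2) **(2) by blast
qed

lemma manifold_UNIV_real: "manifold 1 (UNIV :: real set)"
  unfolding manifold_def
proof
  fix x :: real
  have "bounded_linear (\<lambda>s. seq_cons s 0)"
    by (intro bounded_linear_seq_intros)
  then have "diffeo (Rn 1) (UNIV :: real set) (\<lambda>z. apply_bcontfun z 0)"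
    by (intro diffeoI[where g = "\<lambda>s. seq_cons s 0"] smooth_map_bounded_linear bounded_linear_apply_bcontfun)
      (auto simp: Rn_def seq_apply split: nat.split intro!: bcontfun_eqI)
  then show "\<exists>U V \<phi>. openin (top_of_set (UNIV :: real set)) U \<and> x \<in> U \<and>
      openin (top_of_set (Rn 1)) V \<and> diffeo V U \<phi>"
    by (metis UNIV_I openin_subtopology_self)
qed

lemma manifold_singleton: "manifold 0 {a}"
  unfolding manifold_def
proof
  fix x assume x: "x \<in> {a}"
  have "diffeo (Rn 0) {a} (\<lambda>_. a)"
    by (rule diffeoI[where g = "\<lambda>_. 0"])
      (use smooth_map_affine[OF bounded_linear_zero] in auto)
  with x show "\<exists>U V \<phi>. openin (top_of_set {a}) U \<and> x \<in> U \<and> openin (top_of_set (Rn 0)) V \<and> diffeo V U \<phi>"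
    by (metis openin_subtopology_self)
qed

section \<open>Stably complex manifolds\<close>

lemma mem_stable_fibre: "z \<in> stable_fibre M k x \<longleftrightarrow> fst z \<in> tangent M x \<and> snd z \<in> Rn k"
  by (cases z) (simp add: stable_fibre_def)

lemma mem_Sigma_iff_fst: "q \<in> Sigma A B \<longleftrightarrow> fst q \<in> A \<and> snd q \<in> B (fst q)"
  by (cases q) simp

lemma stable_cxI:
  assumes "\<And>x. x \<in> M \<Longrightarrow> linear (J x)"
    and "\<And>x z. x \<in> M \<Longrightarrow> z \<in> stable_fibre M k x \<Longrightarrow> J x z \<in> stable_fibre M k x"
    and "\<And>x z. x \<in> M \<Longrightarrow> z \<in> stable_fibre M k x \<Longrightarrow> J x (J x z) = - z"
    and "smooth_map (Sigma M (stable_fibre M k)) (\<lambda>q. J (fst q) (snd q))"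
  shows "stable_cx M k J"
  using assms by (auto simp: stable_cx_def case_prod_unfold)

lemma stable_cxD:
  assumes "stable_cx M k J"
  shows "\<And>x. x \<in> M \<Longrightarrow> linear (J x)"
    and "\<And>x z. x \<in> M \<Longrightarrow> z \<in> stable_fibre M k x \<Longrightarrow> J x z \<in> stable_fibre M k x"
    and "\<And>x z. x \<in> M \<Longrightarrow> z \<in> stable_fibre M k x \<Longrightarrow> J x (J x z) = - z"
    and "smooth_map (Sigma M (stable_fibre M k)) (\<lambda>q. J (fst q) (snd q))"
  using assms by (auto simp: stable_cx_def case_prod_unfold)

section \<open>Products of stably complex manifolds\<close>

definition prod_carrier :: "rseq set \<Rightarrow> rseq set \<Rightarrow> rseq set" where
  "prod_carrier M N = (\<lambda>(x, y). interleave x y) ` (M \<times> N)"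

lemma prod_carrier_iff: "p \<in> prod_carrier M N \<longleftrightarrow> seq_evens p \<in> M \<and> seq_odds p \<in> N"
proof
  assume "seq_evens p \<in> M \<and> seq_odds p \<in> N"
  then show "p \<in> prod_carrier M N"
    unfolding prod_carrier_def by (intro image_eqI[where x = "(seq_evens p, seq_odds p)"]) auto
qed (auto simp: prod_carrier_def)

lemma prod_carrier_altdef: "prod_carrier M N = (\<lambda>z. interleave (fst z) (snd z)) ` (M \<times> N)"
  by (simp add: prod_carrier_def case_prod_unfold)

lemma tangent_prod_carrier:
  assumes "p \<in> prod_carrier M N"
  shows "u \<in> tangent (prod_carrier M N) p \<longleftrightarrow>
    seq_evens u \<in> tangent M (seq_evens p) \<and> seq_odds u \<in> tangent N (seq_odds p)"
proof
  assume u: "u \<in> tangent (prod_carrier M N) p"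
  show "seq_evens u \<in> tangent M (seq_evens p) \<and> seq_odds u \<in> tangent N (seq_odds p)"
    by (intro conjI tangent_linear_image[OF bounded_linear_seq_evens _ u]
        tangent_linear_image[OF bounded_linear_seq_odds _ u]) (auto simp: prod_carrier_iff)
next
  assume "seq_evens u \<in> tangent M (seq_evens p) \<and> seq_odds u \<in> tangent N (seq_odds p)"
  with assms have "(seq_evens u, seq_odds u) \<in> tangent (M \<times> N) (seq_evens p, seq_odds p)"
    by (simp add: tangent_Times prod_carrier_iff)
  from tangent_linear_image[OF bounded_linear_interleave _ this, of "prod_carrier M N"]
  show "u \<in> tangent (prod_carrier M N) p"
    by (auto simp: prod_carrier_iff)
qed

lemma prod_struct_altdef:
  "prod_struct k J J' p z =
     (interleave (fst (J (seq_evens p) (seq_evens (fst z), seq_take k (snd z))))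
        (fst (J' (seq_odds p) (seq_odds (fst z), seq_drop k (snd z)))),
      seq_append k (snd (J (seq_evens p) (seq_evens (fst z), seq_take k (snd z))))
        (snd (J' (seq_odds p) (seq_odds (fst z), seq_drop k (snd z)))))"
  by (simp add: prod_struct_def case_prod_unfold Let_def)

lemma manifold_prod_carrier:
  assumes "manifold d M" "manifold e N"
  shows "manifold (d + e) (prod_carrier M N)"
  unfolding prod_carrier_altdef
  by (rule manifold_linear_image[where K = "\<lambda>p. (seq_evens p, seq_odds p)",
        OF bounded_linear_interleave _ _ manifold_Times[OF assms]])
    (auto intro: bounded_linear_seq_intros)

lemma stable_cx_prod:
  assumes J: "stable_cx M k J" and J': "stable_cx N l J'"
  shows "stable_cx (prod_carrier M N) (k + l) (prod_struct k J J')"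
proof (rule stable_cxI)
  let ?P = "prod_carrier M N"
  note J = stable_cxD[OF J] and J' = stable_cxD[OF J']
  fix p assume p: "p \<in> ?P"
  then have x: "seq_evens p \<in> M" and y: "seq_odds p \<in> N" by (simp_all add: prod_carrier_iff)
  note lin_x = J(1)[OF x] and lin_y = J'(1)[OF y]
  have inner1: "linear (\<lambda>z. J (seq_evens p) (seq_evens (fst z), seq_take k (snd z)))"
    by (intro linear_compose[OF _ lin_x, unfolded o_def] bounded_linear.linear bounded_linear_seq_intros)
  have inner2: "linear (\<lambda>z. J' (seq_odds p) (seq_odds (fst z), seq_drop k (snd z)))"
    by (intro linear_compose[OF _ lin_y, unfolded o_def] bounded_linear.linear bounded_linear_seq_intros)
  \<comment> \<open>The fibre maps are only known to be linear, not bounded. Their pairing is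
    checked by hand and the bounded rearrangement of components is composed afterwards.\<close>
  have "linear (\<lambda>z. (J (seq_evens p) (seq_evens (fst z), seq_take k (snd z)),
      J' (seq_odds p) (seq_odds (fst z), seq_drop k (snd z))))"
    by (rule linearI) (simp_all only: linear_add[OF inner1] linear_add[OF inner2] linear_scale[OF inner1]
        linear_scale[OF inner2] add_Pair scaleR_Pair)
  moreover have "linear (\<lambda>q. (interleave (fst (fst q)) (fst (snd q)), seq_append k (snd (fst q)) (snd (snd q))))"
    by (intro bounded_linear.linear bounded_linear_seq_intros)
  ultimately show "linear (prod_struct k J J' p)"
    using linear_compose unfolding prod_struct_altdef[abs_def] by (force simp: o_def)
  fix z assume z: "z \<in> stable_fibre ?P (k + l) p"
  let ?a = "(seq_evens (fst z), seq_take k (snd z))" and ?b = "(seq_odds (fst z), seq_drop k (snd z))"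
  have a: "?a \<in> stable_fibre M k (seq_evens p)" and b: "?b \<in> stable_fibre N l (seq_odds p)"
    using z by (simp_all add: mem_stable_fibre tangent_prod_carrier[OF p] seq_drop_Rn)
  note Ja = J(2)[OF x a] and Jb = J'(2)[OF y b]
  show "prod_struct k J J' p z \<in> stable_fibre ?P (k + l) p"
    using Ja Jb by (simp add: prod_struct_altdef mem_stable_fibre tangent_prod_carrier[OF p] seq_append_Rn)
  \<comment> \<open>The R^k component stays in \<open>Rn k\<close>, so cutting at k undoes the
    joining and the second application of each structure receives exactly the output of its
    first.\<close>
  have "snd (J (seq_evens p) ?a) \<in> Rn k" using Ja by (simp add: mem_stable_fibre)
  then have "prod_struct k J J' p (prod_struct k J J' p z) =
      (interleave (fst (- ?a)) (fst (- ?b)), seq_append k (snd (- ?a)) (snd (- ?b)))"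
    using J(3)[OF x a] J'(3)[OF y b] by (simp add: prod_struct_altdef)
  also have "\<dots> = - z"
    by (rule prod_eqI; rule bcontfun_eqI) (auto simp: seq_apply odd_two_times_div_two_succ)
  finally show "prod_struct k J J' p (prod_struct k J J' p z) = - z" .
next
  let ?S = "Sigma (prod_carrier M N) (stable_fibre (prod_carrier M N) (k + l))"
  note J = stable_cxD(4)[OF J] and J' = stable_cxD(4)[OF J']
  have L: "bounded_linear (\<lambda>q. (seq_evens (fst q), (seq_evens (fst (snd q)), seq_take k (snd (snd q)))))"
    "bounded_linear (\<lambda>q. (seq_odds (fst q), (seq_odds (fst (snd q)), seq_drop k (snd (snd q)))))"
    by (intro bounded_linear_seq_intros)+
  have "smooth_map ?S (\<lambda>q. J (seq_evens (fst q)) (seq_evens (fst (snd q)), seq_take k (snd (snd q))))"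
    by (rule smooth_map_compose_bounded_linear[OF J L(1), simplified])
      (auto simp: mem_stable_fibre tangent_prod_carrier prod_carrier_iff)
  moreover
  have "smooth_map ?S (\<lambda>q. J' (seq_odds (fst q)) (seq_odds (fst (snd q)), seq_drop k (snd (snd q))))"
    by (rule smooth_map_compose_bounded_linear[OF J' L(2), simplified])
      (auto simp: mem_stable_fibre tangent_prod_carrier prod_carrier_iff seq_drop_Rn)
  ultimately have "smooth_map ?S (\<lambda>q. (J (seq_evens (fst q)) (seq_evens (fst (snd q)), seq_take k (snd (snd q))),
      J' (seq_odds (fst q)) (seq_odds (fst (snd q)), seq_drop k (snd (snd q)))))"
    by (rule smooth_map_Pair)
  from smooth_map_linear[OF this, of
      "\<lambda>q. (interleave (fst (fst q)) (fst (snd q)), seq_append k (snd (fst q)) (snd (snd q)))"]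
  show "smooth_map ?S (\<lambda>q. prod_struct k J J' (fst q) (snd q))"
    by (simp add: prod_struct_altdef bounded_linear_seq_intros)
qed

lemma closed_scm_iff:
  "closed_scm (d, M, k, J) \<longleftrightarrow> compact M \<and> (\<exists>N. M \<subseteq> Rn N) \<and> manifold d M \<and> stable_cx M k J"
  by (simp add: closed_scm_def)

lemma closed_scm_prod:
  assumes X: "closed_scm (d, M, k, J)" and Y: "closed_scm (e, N, l, J')"
  shows "closed_scm (d + e, prod_carrier M N, k + l, prod_struct k J J')"
  unfolding closed_scm_iff
proof (intro conjI)
  show "compact (prod_carrier M N)"
    unfolding prod_carrier_altdef using X Y
    by (intro compact_continuous_image linear_continuous_on bounded_linear_interleave compact_Times)
      (simp_all add: closed_scm_iff)
  obtain m n where "M \<subseteq> Rn m" "N \<subseteq> Rn n" using X Y by (auto simp: closed_scm_iff)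
  \<comment> \<open>Coordinate i of an interleaving is coordinate \<open>i div 2\<close> of a
    factor, and i at least 2 * (m + n) puts it beyond both m and n.\<close>
  then have "prod_carrier M N \<subseteq> Rn (2 * (m + n))"
    by (fastforce simp: prod_carrier_def Rn_def seq_apply)
  then show "\<exists>n. prod_carrier M N \<subseteq> Rn n" by blast
qed (use X Y in \<open>simp_all add: closed_scm_iff manifold_prod_carrier stable_cx_prod\<close>)

lemma Rep_scm_prod:
  assumes "Rep_scm X = (d, M, k, J)" "Rep_scm Y = (e, N, l, J')"
  shows "Rep_scm (scm_prod X Y) = (d + e, prod_carrier M N, k + l, prod_struct k J J')"
  using closed_scm_prod[of d M k J e N l J'] Rep_scm[of X] Rep_scm[of Y] assms
  by (simp add: scm_prod_def Abs_scm_inverse prod_carrier_def)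

text \<open>The stable fibre of rank 0 over a point is zero, so the identity does square to minus
  the identity there.\<close>

lemma Rep_scm_point: "Rep_scm scm_point = (0, {0}, 0, \<lambda>_ z. z)"
proof -
  have "stable_cx {0 :: rseq} 0 (\<lambda>_ z. z)"
  proof (rule stable_cxI)
    show "smooth_map (Sigma {0} (stable_fibre {0 :: rseq} 0)) snd"
      by (rule smooth_map_bounded_linear[OF bounded_linear_snd])
    show "linear (\<lambda>z. z)" by (rule linear_ident)
  qed (simp_all add: mem_stable_fibre tangent_singleton prod_eq_iff)
  moreover have "{0} \<subseteq> Rn 0" by simp
  ultimately have "closed_scm (0, {0}, 0, \<lambda>_ z. z)"
    unfolding closed_scm_iff by (intro conjI exI manifold_singleton) simp_all
  then show ?thesis by (simp add: scm_point_def Abs_scm_inverse)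
qed

section \<open>Stabilisation by a trivial complex line\<close>

lemma stab_struct_altdef:
  "stab_struct k J x z = (fst (J x (fst z, seq_take k (snd z))),
     seq_append k (snd (J x (fst z, seq_take k (snd z))))
       (seq_cons (- apply_bcontfun (snd z) (k + 1)) (seq_cons (apply_bcontfun (snd z) k) 0)))"
  by (simp add: stab_struct_def case_prod_unfold Let_def)

lemma stable_cx_stab:
  assumes J: "stable_cx M k J"
  shows "stable_cx M (k + 2) (stab_struct k J)"
proof (rule stable_cxI)
  \<comment> \<open>Beyond the value of J, the last two coordinates of the argument itself enter.
    The structure is therefore the linear map \<open>?Q\<close> applied to the pair of that value
    and the argument, which yields both linearity and smoothness.\<close>
  let ?Q = "\<lambda>q. (fst (fst q), seq_append k (snd (fst q))
    (seq_cons (- apply_bcontfun (snd (snd q)) (k + 1)) (seq_cons (apply_bcontfun (snd (snd q)) k) 0)))"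
  note J = stable_cxD[OF J]
  have Q: "bounded_linear ?Q"
    by (intro bounded_linear_seq_intros)
  show "smooth_map (Sigma M (stable_fibre M (k + 2))) (\<lambda>q. stab_struct k J (fst q) (snd q))"
  proof -
    let ?S = "Sigma M (stable_fibre M (k + 2))"
    have "bounded_linear (\<lambda>q. (fst q, (fst (snd q), seq_take k (snd (snd q)))))"
      by (intro bounded_linear_seq_intros)
    from smooth_map_compose_bounded_linear[OF J(4) this, of ?S]
    have "smooth_map ?S (\<lambda>q. J (fst q) (fst (snd q), seq_take k (snd (snd q))))"
      by (simp add: mem_Sigma_iff_fst mem_stable_fibre)
    from smooth_map_linear[OF smooth_map_Pair[OF this smooth_map_bounded_linear[OF bounded_linear_snd]] Q]
    show ?thesis by (simp add: stab_struct_altdef)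
  qed
  fix x assume x: "x \<in> M"
  have inner: "linear (\<lambda>z. J x (fst z, seq_take k (snd z)))"
    by (intro linear_compose[OF _ J(1)[OF x], unfolded o_def] bounded_linear.linear bounded_linear_seq_intros)
  have "linear (\<lambda>z. (J x (fst z, seq_take k (snd z)), z))"
    by (rule linearI) (simp_all only: linear_add[OF inner] linear_scale[OF inner] add_Pair scaleR_Pair)
  from linear_compose[OF this bounded_linear.linear[OF Q]]
  show "linear (stab_struct k J x)"
    unfolding stab_struct_altdef[abs_def] by (simp add: o_def)
  fix z assume z: "z \<in> stable_fibre M (k + 2) x"
  let ?a = "(fst z, seq_take k (snd z))"
  have a: "?a \<in> stable_fibre M k x" using z by (simp add: mem_stable_fibre)
  then have Ja: "fst (J x ?a) \<in> tangent M x" "snd (J x ?a) \<in> Rn k"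
    using J(2)[OF x a] by (simp_all add: mem_stable_fibre)
  have "seq_cons s (seq_cons t 0) \<in> Rn 2" for s t
    using seq_cons_Rn[OF seq_cons_Rn[OF zero_in_Rn[of 0]]] by (simp add: numeral_2_eq_2)
  with Ja show "stab_struct k J x z \<in> stable_fibre M (k + 2) x"
    by (simp add: stab_struct_altdef mem_stable_fibre seq_append_Rn del: add_2_eq_Suc')
  have "stab_struct k J x (stab_struct k J x z) = (fst (- ?a), seq_append k (snd (- ?a))
      (seq_cons (- apply_bcontfun (snd z) k) (seq_cons (- apply_bcontfun (snd z) (k + 1)) 0)))"
    using J(3)[OF x a] Ja by (simp add: stab_struct_altdef seq_append.rep_eq seq_cons.rep_eq)
  also have "\<dots> = - z"
    using seq_append_take_two[of "- snd z" k] z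
    by (simp add: prod_eq_iff mem_stable_fibre Rn_def uminus_bcontfun.rep_eq
        linear_neg[OF bounded_linear.linear[OF bounded_linear_seq_take]])
  finally show "stab_struct k J x (stab_struct k J x z) = - z" .
qed

lemma ex_stabilisation:
  assumes "Rep_scm X = (d, M, k, J)"
  obtains X' where "stabilisation X X'" "Rep_scm X' = (d, M, k + 2, stab_struct k J)"
proof
  have "closed_scm (d, M, k + 2, stab_struct k J)"
    using Rep_scm[of X] assms stable_cx_stab by (simp add: closed_scm_iff)
  then show *: "Rep_scm (Abs_scm (d, M, k + 2, stab_struct k J)) = (d, M, k + 2, stab_struct k J)"
    by (simp add: Abs_scm_inverse)
  show "stabilisation X (Abs_scm (d, M, k + 2, stab_struct k J))"
    unfolding stabilisation_def using assms * by blast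
qed

section \<open>Linearly isomorphic manifolds are bordant\<close>

text \<open>The structure on TM + R^(k+1) is read on T(M x R) + R^k, constant along the line. The
  line direction is the first basis vector of R^(k+1), matching the convention of
  \<open>collar\<close>.\<close>

definition cylinder_struct ::
  "sc_struct \<Rightarrow> rseq \<times> real \<Rightarrow> (rseq \<times> real) \<times> rseq \<Rightarrow> (rseq \<times> real) \<times> rseq" where
  "cylinder_struct J p z = (let (w, b) = J (fst p) (fst (fst z), seq_cons (snd (fst z)) (snd z)) in
     ((w, apply_bcontfun b 0), seq_drop 1 b))"

text \<open>The maps \<open>?I\<close> and \<open>?Q\<close> are mutually inverse linear
  identifications of the two fibres, and the cylinder structure is J conjugated by them, so the
  defining properties of J carry over.\<close>

lemma stable_cx_cylinder:
  assumes J: "stable_cx M (Suc k) J"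
  shows "stable_cx (M \<times> UNIV) k (cylinder_struct J)"
proof (rule stable_cxI)
  let ?I = "\<lambda>z :: (rseq \<times> real) \<times> rseq. (fst (fst z), seq_cons (snd (fst z)) (snd z))"
  let ?Q = "\<lambda>z :: rseq \<times> rseq. ((fst z, apply_bcontfun (snd z) 0), seq_drop 1 (snd z))"
  have def: "cylinder_struct J p z = ?Q (J (fst p) (?I z))" for p z
    by (simp add: cylinder_struct_def case_prod_unfold Let_def)
  have Q: "bounded_linear ?Q" by (intro bounded_linear_seq_intros)
  have IQ: "?I (?Q z) = z" and QI: "?Q (?I y) = y" for z y by simp_all
  note J = stable_cxD[OF J]
  let ?S = "Sigma (M \<times> UNIV) (stable_fibre (M \<times> (UNIV :: real set)) k)"
  have fibre: "z \<in> stable_fibre (M \<times> UNIV) k p \<longleftrightarrow> ?I z \<in> stable_fibre M (Suc k) (fst p)"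
    if "fst p \<in> M" for p and z :: "(rseq \<times> real) \<times> rseq"
  proof -
    have "snd z \<in> Rn k \<longleftrightarrow> seq_cons (snd (fst z)) (snd z) \<in> Rn (Suc k)"
      using seq_cons_Rn[of "snd z" k] seq_drop_Rn[of "seq_cons (snd (fst z)) (snd z)" 1 k] by auto
    moreover have "fst z \<in> tangent (M \<times> UNIV) p \<longleftrightarrow> fst (fst z) \<in> tangent M (fst p)"
      using tangent_Times[OF that UNIV_I, of "snd p"] by (simp add: tangent_UNIV_real mem_Times_iff)
    ultimately show ?thesis by (simp add: mem_stable_fibre)
  qed
  show "smooth_map ?S (\<lambda>q. cylinder_struct J (fst q) (snd q))"
  proof -
    have "bounded_linear (\<lambda>q. (fst (fst q), ?I (snd q)))"
      by (intro bounded_linear_seq_intros)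
    note * = smooth_map_compose_bounded_linear[OF J(4) this]
    have "smooth_map ?S (\<lambda>q. J (fst (fst q)) (?I (snd q)))"
      by (rule *[unfolded fst_conv snd_conv]) (use fibre in \<open>auto simp: mem_Sigma_iff_fst\<close>)
    from smooth_map_linear[OF this Q] show ?thesis by (simp add: def)
  qed
  fix p assume "p \<in> M \<times> (UNIV :: real set)"
  then have p: "fst p \<in> M" by auto
  have "linear ?I" by (intro bounded_linear.linear bounded_linear_seq_intros)
  from linear_compose[OF linear_compose[OF this J(1)[OF p]] bounded_linear.linear[OF Q]]
  show "linear (cylinder_struct J p)"
    unfolding def[abs_def] by (simp add: o_def)
  fix z assume z: "z \<in> stable_fibre (M \<times> UNIV) k p"
  then have z': "?I z \<in> stable_fibre M (Suc k) (fst p)" using fibre[OF p] by simp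
  show "cylinder_struct J p z \<in> stable_fibre (M \<times> UNIV) k p"
    unfolding fibre[OF p] def IQ using J(2)[OF p z'] by simp
  have "cylinder_struct J p (cylinder_struct J p z) = ?Q (- ?I z)"
    unfolding def using J(3)[OF p z'] by simp
  also have "\<dots> = - z"
    using linear_neg[OF bounded_linear.linear[OF Q], of "?I z"] by (simp only: QI)
  finally show "cylinder_struct J p (cylinder_struct J p z) = - z" .
qed

text \<open>L stands for its own derivative on tangent vectors, and the trivial summand is matched
  by the identity, without any rotation.\<close>

definition struct_iso :: "rseq set \<Rightarrow> nat \<Rightarrow> sc_struct \<Rightarrow> rseq set \<Rightarrow> sc_struct \<Rightarrow> (rseq \<Rightarrow> rseq) \<Rightarrow> bool" where
  "struct_iso M k J M' J' L \<longleftrightarrow>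
     (\<forall>x\<in>M. \<forall>w\<in>tangent M x. \<forall>a\<in>Rn k. J' (L x) (L w, a) = map_prod L id (J x (w, a)))"

text \<open>The collar sends (x, t) to (L x, a + t). Being affine it has derivative L on M and the
  identity on the line, so the collar equation becomes \<open>struct_iso\<close> at the vector
  \<open>seq_cons s b\<close>. The width 1 is a convenient choice, the cylinder being a product
  along the whole line.\<close>

lemma collar_cylinder:
  assumes L: "bounded_linear L" and K: "bounded_linear K"
    and LM: "\<And>x. x \<in> M \<Longrightarrow> L x \<in> M'" "\<And>y. y \<in> M' \<Longrightarrow> K y \<in> M"
      "\<And>x. x \<in> M \<Longrightarrow> K (L x) = x" "\<And>y. y \<in> M' \<Longrightarrow> L (K y) = y"
    and J: "struct_iso M (Suc k) J M' J' L"
  shows "collar M k J (M' \<times> UNIV) snd (cylinder_struct J') a"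
  unfolding collar_def
proof (intro exI conjI ballI allI)
  let ?c = "\<lambda>z :: rseq \<times> real. (L (fst z), snd z) + (0, a)"
  let ?W = "{z \<in> M' \<times> UNIV. a - 1 < snd z \<and> snd z < a + 1}"
  have Lc: "bounded_linear (\<lambda>z. (L (fst z), snd z))" "bounded_linear (\<lambda>z. (K (fst z), snd z))"
    by (intro bounded_linear_seq_intros bounded_linear_compose[OF L] bounded_linear_compose[OF K])+
  show "(0 :: real) < 1" by simp
  show "diffeo (M \<times> {- 1<..<1}) ?W ?c"
  proof (rule diffeoI[where g = "\<lambda>z. (K (fst z), snd z) + (0, - a)"])
    show "smooth_map (M \<times> {- 1<..<1}) ?c" by (rule smooth_map_affine[OF Lc(1)])
    show "smooth_map ?W (\<lambda>z. (K (fst z), snd z) + (0, - a))" by (rule smooth_map_affine[OF Lc(2)])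
  qed (use LM in auto)
  fix x assume x: "x \<in> M"
  show "snd (?c (x, t)) = a + t" for t by simp
  show "(?c has_derivative (\<lambda>z. (L (fst z), snd z))) (at (x, 0) within M \<times> {- 1<..<1})"
    by (rule has_derivative_affine[OF Lc(1)])
  fix w s b assume w: "w \<in> tangent M x" and b: "b \<in> Rn k"
  have "J' (L x) (L w, seq_cons s b) = map_prod L id (J x (w, seq_cons s b))"
    using J x w seq_cons_Rn[OF b] by (auto simp: struct_iso_def)
  then show "cylinder_struct J' (?c (x, 0)) ((L (fst (w, s)), snd (w, s)), b) =
      (let (w', b') = J x (w, seq_cons s b) in ((L (fst (w', apply_bcontfun b' 0)), snd (w', apply_bcontfun b' 0)), seq_drop 1 b'))"
    by (simp add: cylinder_struct_def case_prod_unfold Let_def map_prod_def)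
qed

lemma cobordantI_linear:
  assumes X: "Rep_scm X = (d, M, Suc k, J)" and X': "Rep_scm X' = (d, M', Suc k, J')"
    and L: "bounded_linear L" and K: "bounded_linear K"
    and LM: "\<And>x. x \<in> M \<Longrightarrow> L x \<in> M'" "\<And>y. y \<in> M' \<Longrightarrow> K y \<in> M"
      "\<And>x. x \<in> M \<Longrightarrow> K (L x) = x" "\<And>y. y \<in> M' \<Longrightarrow> L (K y) = y"
    and J: "struct_iso M (Suc k) J M' J' L"
  shows "cobordant X X'"
  unfolding cobordant_def
proof (intro exI conjI)
  have M': "compact M'" "manifold d M'" "stable_cx M' (Suc k) J'" "\<exists>N. M' \<subseteq> Rn N"
    using Rep_scm[of X'] X' by (simp_all add: closed_scm_iff)
  show "M' \<times> UNIV \<subseteq> Rn (SOME N. M' \<subseteq> Rn N) \<times> (UNIV :: real set)"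
    using someI_ex[OF M'(4)] by blast
  show "manifold (Suc d) (M' \<times> (UNIV :: real set))"
    using manifold_Times[OF M'(2) manifold_UNIV_real] by simp
  show "stable_cx (M' \<times> UNIV) k (cylinder_struct J')"
    by (rule stable_cx_cylinder[OF M'(3)])
  show "smooth_map (M' \<times> (UNIV :: real set)) snd"
    by (rule smooth_map_bounded_linear[OF bounded_linear_snd])
  have "{z \<in> M' \<times> UNIV. 0 \<le> snd z \<and> snd z \<le> (1 :: real)} = M' \<times> {0..1}" by auto
  then show "compact {z \<in> M' \<times> UNIV. 0 \<le> snd z \<and> snd z \<le> (1 :: real)}"
    by (simp add: compact_Times M'(1))
  show "collar M k J (M' \<times> UNIV) snd (cylinder_struct J') 0"
    by (rule collar_cylinder[OF L K LM J])
  show "collar M' k J' (M' \<times> UNIV) snd (cylinder_struct J') 1"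
    by (rule collar_cylinder[OF bounded_linear_ident bounded_linear_ident]) (auto simp: struct_iso_def map_prod_def)
qed (fact X X')+

text \<open>Stabilising adds the same quarter turn on both sides, and L is the identity on trivial
  coordinates, so \<open>struct_iso\<close> persists. The relations along X, Y, Y', X'
  telescope.\<close>

lemma bordism_ideal_linear_iso:
  assumes X: "Rep_scm X = (d, M, k, J)" and X': "Rep_scm X' = (d, M', k, J')"
    and L: "bounded_linear L" and K: "bounded_linear K"
    and LM: "\<And>x. x \<in> M \<Longrightarrow> L x \<in> M'" "\<And>y. y \<in> M' \<Longrightarrow> K y \<in> M"
      "\<And>x. x \<in> M \<Longrightarrow> K (L x) = x" "\<And>y. y \<in> M' \<Longrightarrow> L (K y) = y"
    and J: "struct_iso M k J M' J' L"
  shows "Poly_Mapping.single X c - Poly_Mapping.single X' c \<in> bordism_ideal"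
proof -
  obtain Y where Y: "stabilisation X Y" "Rep_scm Y = (d, M, k + 2, stab_struct k J)"
    by (rule ex_stabilisation[OF X])
  obtain Y' where Y': "stabilisation X' Y'" "Rep_scm Y' = (d, M', k + 2, stab_struct k J')"
    by (rule ex_stabilisation[OF X'])
  have "cobordant Y Y'"
  proof (rule cobordantI_linear[OF _ _ L K LM])
    show "Rep_scm Y = (d, M, Suc (Suc k), stab_struct k J)"
      "Rep_scm Y' = (d, M', Suc (Suc k), stab_struct k J')"
      using Y Y' by simp_all
    show "struct_iso M (Suc (Suc k)) (stab_struct k J) M' (stab_struct k J') L"
      using J by (simp add: struct_iso_def stab_struct_altdef map_prod_def case_prod_unfold)
  qed
  then have "(Poly_Mapping.single X c - Poly_Mapping.single Y c) +
      (Poly_Mapping.single Y c - Poly_Mapping.single Y' c) -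
      (Poly_Mapping.single X' c - Poly_Mapping.single Y' c) \<in> bordism_ideal"
    using Y(1) Y'(1)
    by (intro bordism_ideal_minus bordism_ideal.add bordism_ideal.cobordant bordism_ideal.stabilisation)
  then show ?thesis by simp
qed

text \<open>With a non-zero stabilisation of the second factor, commutativity would need a homotopy
  exchanging the two stabilising summands; the moduli spaces below carry none.\<close>

lemma scm_prod_commute:
  assumes Y: "Rep_scm Y = (e, N, 0, J')"
  shows "Poly_Mapping.single (scm_prod X Y) c - Poly_Mapping.single (scm_prod Y X) c \<in> bordism_ideal"
proof -
  obtain d M k J where X: "Rep_scm X = (d, M, k, J)" by (metis prod_cases4)
  have J: "stable_cx M k J" and J': "stable_cx N 0 J'"
    using Rep_scm[of X] X Rep_scm[of Y] Y by (simp_all add: closed_scm_iff)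
  \<comment> \<open>The swap of even and odd coordinates undoes itself, so it serves as the
    isomorphism and as its inverse.\<close>
  let ?L = "\<lambda>u. interleave (seq_odds u) (seq_evens u)"
  have L: "bounded_linear ?L" by (intro bounded_linear_seq_intros)
  have "struct_iso (prod_carrier M N) k (prod_struct k J J') (prod_carrier N M) (prod_struct 0 J' J) ?L"
    unfolding struct_iso_def
  proof (intro ballI)
    fix p w a
    assume p: "p \<in> prod_carrier M N" and w: "w \<in> tangent (prod_carrier M N) p" and a: "a \<in> Rn k"
    have xy: "seq_evens p \<in> M" "seq_odds p \<in> N" using p by (simp_all add: prod_carrier_iff)
    have "(seq_evens w, a) \<in> stable_fibre M k (seq_evens p)"
      "(seq_odds w, 0) \<in> stable_fibre N 0 (seq_odds p)"
      using w a by (simp_all add: tangent_prod_carrier[OF p] mem_stable_fibre)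
    \<comment> \<open>In either order all of R^k goes to J, while J' receives and returns 0 in its
      trivial part. Both joined sequences thus equal the trivial component of J.\<close>
    then have "snd (J (seq_evens p) (seq_evens w, a)) \<in> Rn k"
      "snd (J' (seq_odds p) (seq_odds w, 0)) = 0"
      using stable_cxD(2)[OF J xy(1)] stable_cxD(2)[OF J' xy(2)] by (simp_all add: mem_stable_fibre)
    with a show "prod_struct 0 J' J (?L p) (?L w, a) = map_prod ?L id (prod_struct k J J' p (w, a))"
      by (simp add: prod_struct_altdef seq_take_id seq_drop_Rn_0 seq_append_0_right)
  qed
  with Rep_scm_prod[OF X Y] Rep_scm_prod[OF Y X] show ?thesis
    by (intro bordism_ideal_linear_iso[OF _ _ L L]) (auto simp: prod_carrier_iff add.commute)
qed

lemma interleave_0_odds: "seq_evens p = 0 \<Longrightarrow> interleave 0 (seq_odds p) = p"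
  by (metis interleave_evens_odds)

lemma scm_prod_point_left: "Poly_Mapping.single (scm_prod scm_point X) c - Poly_Mapping.single X c \<in> bordism_ideal"
proof -
  obtain d M k J where X: "Rep_scm X = (d, M, k, J)" by (metis prod_cases4)
  have L: "bounded_linear (\<lambda>x. interleave 0 x)" by (intro bounded_linear_seq_intros)
  have "struct_iso M k J (prod_carrier {0} M) (prod_struct 0 (\<lambda>_ z. z) J) (\<lambda>x. interleave 0 x)"
    by (simp add: struct_iso_def prod_struct_altdef map_prod_def case_prod_unfold)
  then have "Poly_Mapping.single X c - Poly_Mapping.single (scm_prod scm_point X) c \<in> bordism_ideal"
    using Rep_scm_prod[OF Rep_scm_point X]
    by (intro bordism_ideal_linear_iso[OF X _ L bounded_linear_seq_odds])
      (auto simp: prod_carrier_iff intro: interleave_0_odds)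
  from bordism_ideal_uminus[OF this] show ?thesis by simp
qed

text \<open>The point is itself unstabilised, so the commutation of products reduces this to the
  left unit.\<close>

lemma scm_prod_point_right: "Poly_Mapping.single (scm_prod X scm_point) c - Poly_Mapping.single X c \<in> bordism_ideal"
  using bordism_ideal.add[OF scm_prod_commute[OF Rep_scm_point, of X c] scm_prod_point_left[of X c]] by simp

section \<open>The bordism ring\<close>

lemma bordism_ideal_sum: "(\<And>x. x \<in> A \<Longrightarrow> f x \<in> bordism_ideal) \<Longrightarrow> sum f A \<in> bordism_ideal"
  by (induction A rule: infinite_finite_induct) (auto intro: bordism_ideal.intros)

lemma free_mult_single_right:
  "free_mult f (Poly_Mapping.single Y c) =
     (\<Sum>X\<in>Poly_Mapping.keys f. Poly_Mapping.single (scm_prod X Y) (Poly_Mapping.lookup f X * c))"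
  by (subst free_mult_superset[where S = "Poly_Mapping.keys f" and T = "{Y}"]) auto

lemma free_mult_single_left:
  "free_mult (Poly_Mapping.single Y c) f =
     (\<Sum>X\<in>Poly_Mapping.keys f. Poly_Mapping.single (scm_prod Y X) (c * Poly_Mapping.lookup f X))"
  by (subst free_mult_superset[where S = "{Y}" and T = "Poly_Mapping.keys f"]) auto

lemma sum_single_lookup: "(\<Sum>X\<in>Poly_Mapping.keys f. Poly_Mapping.single X (Poly_Mapping.lookup f X)) = f"
  for f :: "scm \<Rightarrow>\<^sub>0 rat"
proof -
  have "free_scale 1 f = f" by (rule poly_mapping_eqI) (simp add: lookup_free_scale)
  then show ?thesis by (simp add: free_scale_def)
qed

lemma free_scale_single: "free_scale c (Poly_Mapping.single X 1) = Poly_Mapping.single X c"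
  by (rule poly_mapping_eqI) (simp add: lookup_free_scale lookup_single when_def)

text \<open>The zero laws collapse the delta sums in the unit laws for series.\<close>

instance mu :: mult_zero
  by standard (transfer, simp add: free_mult_def bordism_ideal.zero)+

text \<open>A representative is a finite combination of manifolds, and each term changes by an
  element of the ideal with its own coefficient; hence the arbitrary c in the relations for single
  manifolds.\<close>

lemma mu_one_mult: "1 * a = (a :: mu)"
proof transfer
  fix f :: "scm \<Rightarrow>\<^sub>0 rat"
  have "(\<Sum>X\<in>Poly_Mapping.keys f. Poly_Mapping.single (scm_prod scm_point X) (Poly_Mapping.lookup f X) -
      Poly_Mapping.single X (Poly_Mapping.lookup f X)) \<in> bordism_ideal"
    by (rule bordism_ideal_sum) (rule scm_prod_point_left)
  then show "free_mult (Poly_Mapping.single scm_point 1) f - f \<in> bordism_ideal"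
    by (simp add: free_mult_single_left sum_subtractf sum_single_lookup)
qed

lemma mu_mult_one: "a * 1 = (a :: mu)"
proof transfer
  fix f :: "scm \<Rightarrow>\<^sub>0 rat"
  have "(\<Sum>X\<in>Poly_Mapping.keys f. Poly_Mapping.single (scm_prod X scm_point) (Poly_Mapping.lookup f X) -
      Poly_Mapping.single X (Poly_Mapping.lookup f X)) \<in> bordism_ideal"
    by (rule bordism_ideal_sum) (rule scm_prod_point_right)
  then show "free_mult f (Poly_Mapping.single scm_point 1) - f \<in> bordism_ideal"
    by (simp add: free_mult_single_right sum_subtractf sum_single_lookup)
qed

text \<open>The factor c is carried along because the coefficients of the series are classes divided
  by factorials. It turns into the coefficient of one generator, and rational coefficients
  commute.\<close>

lemma scaleQ_bordism_class_commute:
  assumes "Rep_scm Y = (e, N, 0, J)"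
  shows "a * scaleQ c (bordism_class Y) = scaleQ c (bordism_class Y) * a"
  using assms
proof (transfer fixing: Y e N J c)
  fix f :: "scm \<Rightarrow>\<^sub>0 rat"
  assume "Rep_scm Y = (e, N, 0, J)"
  then have "(\<Sum>X\<in>Poly_Mapping.keys f. Poly_Mapping.single (scm_prod X Y) (Poly_Mapping.lookup f X * c) -
      Poly_Mapping.single (scm_prod Y X) (Poly_Mapping.lookup f X * c)) \<in> bordism_ideal"
    by (intro bordism_ideal_sum scm_prod_commute)
  then show "free_mult f (free_scale c (Poly_Mapping.single Y 1)) -
      free_mult (free_scale c (Poly_Mapping.single Y 1)) f \<in> bordism_ideal"
    by (simp add: free_scale_single free_mult_single_left free_mult_single_right sum_subtractf mult.commute)
qed

section \<open>Degree and centrality of the moduli classes\<close>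

lemma scaleQ_0: "scaleQ c 0 = 0"
  by transfer (simp add: free_scale_def bordism_ideal.zero)

lemma zero_in_MU_degree: "0 \<in> MU_degree m"
  unfolding MU_degree_def zero_mu_def by (intro imageI) simp

lemma scaleQ_bordism_class_degree: "int (scm_dim X) = - m \<Longrightarrow> scaleQ c (bordism_class X) \<in> MU_degree m"
  unfolding MU_degree_def
  by (intro image_eqI[of _ _ "Poly_Mapping.single X c"])
    (auto simp: bordism_class.abs_eq scaleQ.abs_eq free_scale_single)

text \<open>All that is retained of the moduli space is that its class is the default 0 or comes
  from a manifold of rank 0 and known dimension; centrality and degree follow in both cases.\<close>

lemma Mbar_class_cases:
  obtains "Mbar_class n = 0"
  | X M J where "Rep_scm X = (2 * (n - 3), M, 0, J)" "Mbar_class n = bordism_class X"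
proof (cases "\<exists>M J. is_Mbar n M J")
  case True
  then obtain M J where MJ: "is_Mbar n M J" by blast
  \<comment> \<open>The clause \<open>closed_scm\<close> of \<open>is_Mbar\<close> makes the tuple a
    genuine \<open>scm\<close>, so the choice in \<open>Mbar_class\<close> has a witness.\<close>
  then have "Rep_scm (Abs_scm (2 * (n - 3), M, 0, J)) = (2 * (n - 3), M, 0, J)"
    by (simp add: is_Mbar_def Abs_scm_inverse)
  with MJ have "\<exists>X M J. is_Mbar n M J \<and> Rep_scm X = (2 * (n - 3), M, 0, J)" by blast
  from someI_ex[OF this] that(2) True show ?thesis by (auto simp: Mbar_class_def)
qed (use that(1) in \<open>simp add: Mbar_class_def\<close>)

lemma Mbar_class_commute: "a * scaleQ c (Mbar_class n) = scaleQ c (Mbar_class n) * a"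
  by (cases n rule: Mbar_class_cases) (simp_all add: scaleQ_0 scaleQ_bordism_class_commute)

text \<open>With n = k + 3 the real dimension 2 * (n - 3) is exactly 2 * k, and cohomological degree
  is minus the dimension.\<close>

lemma Mbar_class_degree: "scaleQ c (Mbar_class (k + 3)) \<in> MU_degree (- 2 * int k)"
  by (cases "k + 3" rule: Mbar_class_cases)
    (simp_all add: scaleQ_0 zero_in_MU_degree scaleQ_bordism_class_degree scm_dim_def)

section \<open>Laurent series\<close>

text \<open>A product of Laurent series is a convolution of base factors, shifted by the sum of the
  subdegrees. Reversing the convolution by i -> n - i pairs the same coefficients in the other
  order, so their pairwise commutation is enough.\<close>

lemma fls_mult_commute:
  fixes f g :: "'a::{comm_monoid_add, times} fls"
  assumes "\<And>i j. fls_nth f i * fls_nth g j = fls_nth g j * fls_nth f i"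
  shows "f * g = g * f"
proof -
  have "fls_base_factor_to_fps f * fls_base_factor_to_fps g =
      fls_base_factor_to_fps g * fls_base_factor_to_fps f" (is "?F * ?G = _")
  proof (rule fps_ext)
    fix n
    show "fps_nth (?F * ?G) n = fps_nth (?G * ?F) n"
      unfolding fps_mult_nth
      by (rule sum.reindex_bij_witness[of _ "\<lambda>i. n - i" "\<lambda>i. n - i"])
        (auto simp: fls_base_factor_to_fps_nth assms)
  qed
  then show ?thesis by (simp only: fls_times_def add.commute)
qed

text \<open>The series 1 has subdegree 0 and base factor 1, so the claim reduces to power series,
  where the convolution has a single surviving term.\<close>

lemma fls_left_unit:
  fixes f :: "'a::{comm_monoid_add, mult_zero, one} fls"
  assumes "\<And>a :: 'a. 1 * a = a"
  shows "1 * f = f"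
proof -
  have "1 * g = g" for g :: "'a fps"
    by (rule fps_ext) (simp add: fps_mult_nth mult_delta_left assms)
  then show ?thesis
    using fls_conv_base_factor_to_fps_shift_subdegree[of f] by (simp add: fls_times_def)
qed

lemma fls_right_unit:
  fixes f :: "'a::{comm_monoid_add, mult_zero, one} fls"
  assumes "\<And>a :: 'a. a * 1 = a"
  shows "f * 1 = f"
proof -
  have "g * 1 = g" for g :: "'a fps"
    by (rule fps_ext) (simp add: fps_mult_nth mult_delta_right assms)
  then show ?thesis
    using fls_conv_base_factor_to_fps_shift_subdegree[of f] by (simp add: fls_times_def)
qed

section \<open>The quantum product\<close>

lemma tau3_pt_eq: "tau3_pt = divided_power_series (\<lambda>k. Mbar_class (k + 3))"
  by (simp add: tau3_pt_def fls_left_unit[OF mu_one_mult] add.commute)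

lemma quantum_prod_eq: "quantum_prod x y = x * tau3_pt * y"
  by (simp add: quantum_prod_def trace_pt_def transfer_pt_def fls_left_unit[OF mu_one_mult])

lemma coupling_constant_eq: "coupling_constant = tau3_pt"
  by (simp add: coupling_constant_def quantum_prod_eq fls_left_unit[OF mu_one_mult]
      fls_right_unit[OF mu_mult_one])

lemma tau3_pt_nth:
  "fls_nth tau3_pt j = (if j < 0 then 0 else scaleQ (1 / fact (nat j)) (Mbar_class (nat j + 3)))"
  by (simp add: tau3_pt_eq divided_power_series_def)

lemma tau3_pt_commute: "x * tau3_pt = tau3_pt * x"
  by (rule fls_mult_commute) (simp add: tau3_pt_nth Mbar_class_commute)

lemma tau3_pt_degree: "tau3_pt \<in> MUL_degree 0"
proof -
  have "fls_nth tau3_pt j \<in> MU_degree (0 - 2 * j)" for j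
    \<comment> \<open>Coefficients at negative j are zero, which lies in every degree; otherwise
      \<open>nat j\<close> recovers j and the degree -2j cancels that of v^j.\<close>
    using Mbar_class_degree[of "1 / fact (nat j)" "nat j"]
    by (auto simp: tau3_pt_nth zero_in_MU_degree)
  then show ?thesis by (simp add: MUL_degree_def)
qed

theorem corollary2p3:
  shows "coupling_constant = divided_power_series (\<lambda>k. Mbar_class (k + 3)) \<and>
    coupling_constant \<in> MUL_degree 0 \<and>
    (\<forall>x\<in>MUL. \<forall>y\<in>MUL. quantum_prod x y = coupling_constant * x * y)"
  \<comment> \<open>The product reads \<open>(x * tau3_pt) * y\<close>; one exchange gives
    \<open>(tau3_pt * x) * y\<close>, already bracketed as in the claim.\<close>
  using tau3_pt_eq tau3_pt_degree tau3_pt_commute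
  by (simp add: coupling_constant_eq quantum_prod_eq)

end
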